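(* Let $3\leq g<n$ and let $G$ be a unicyclic graph on $n$ vertices with girth $g$. Then $F(G)\leq F(U_{n,g}^p)$, with equality if and only if $G$ is isomorphic to $U_{n,g}^p$. Moreover, $$F(U_{n,g}^p)=n+g^2-g+1+(2^{n-g}-1)\left(2g+\binom{g-1}{2}\right).$$
   Context: All graphs are finite, simple and undirected. A unicyclic graph is a connected graph with the same number of vertices and edges; its girth is the length of its unique cycle. The pineapple graph $U_{n,g}^p$ ($3\leq g<n$) is obtained from the cycle $C_g$ by attaching $n-g$ new pendant vertices to a single vertex of the cycle. A connected subgraph of a graph $G=(V,E)$ is a graph $(V',E')$ with $\emptyset\neq V'\subseteq V$, $E'\subseteq E$, every edge of $E'$ having both endpoints in $V'$, and $(V',E')$ connected; distinct pairs $(V',E')$ are counted separately. The core index $F(G)$ is the number of connected subgraphs of $G$. *)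

theory Defs
  imports Complex_Main
begin

type_synonym 'a graph = "'a set \<times> 'a set set"

abbreviation verts :: "'a graph \<Rightarrow> 'a set" where
  "verts \<equiv> fst"

abbreviation edges :: "'a graph \<Rightarrow> 'a set set" where
  "edges \<equiv> snd"

definition simple_graph :: "'a graph \<Rightarrow> bool" where
  "simple_graph G \<longleftrightarrow> finite (verts G) \<and> (\<forall>e\<in>edges G. e \<subseteq> verts G \<and> card e = 2)"

definition adj_rel :: "'a graph \<Rightarrow> ('a \<times> 'a) set" where
  "adj_rel G = {(u, v). {u, v} \<in> edges G}"

definition connected_graph :: "'a graph \<Rightarrow> bool" where
  "connected_graph G \<longleftrightarrow> simple_graph G \<and> verts G \<noteq> {} \<and>
     (\<forall>u\<in>verts G. \<forall>v\<in>verts G. (u, v) \<in> (adj_rel G)\<^sup>*)"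

definition subgraph :: "'a graph \<Rightarrow> 'a graph \<Rightarrow> bool" where
  "subgraph H G \<longleftrightarrow> simple_graph H \<and> verts H \<subseteq> verts G \<and> edges H \<subseteq> edges G"

definition graph_iso :: "'a graph \<Rightarrow> 'b graph \<Rightarrow> bool" where
  "graph_iso G H \<longleftrightarrow> (\<exists>f. bij_betw f (verts G) (verts H) \<and>
     (\<forall>u\<in>verts G. \<forall>v\<in>verts G. {u, v} \<in> edges G \<longleftrightarrow> {f u, f v} \<in> edges H))"

definition unicyclic :: "'a graph \<Rightarrow> bool" where
  "unicyclic G \<longleftrightarrow> connected_graph G \<and> card (verts G) = card (edges G)"

(* A cycle of length k only when k >= 3: for smaller k the edge set degenerates. *)
definition cycle_graph :: "nat \<Rightarrow> nat graph" where
  "cycle_graph k = ({0..<k}, {{i, Suc i mod k} | i. i < k})"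

definition is_cycle :: "'a graph \<Rightarrow> bool" where
  "is_cycle C \<longleftrightarrow> simple_graph C \<and> (\<exists>k\<ge>3. graph_iso C (cycle_graph k))"

(* The length of the unique cycle; only meaningful when G has exactly one cycle,
   in particular for unicyclic G. *)
definition girth :: "'a graph \<Rightarrow> nat" where
  "girth G = card (edges (THE C. subgraph C G \<and> is_cycle C))"

(* Cycle on 0, ..., g - 1 with the pendant vertices g, ..., n - 1 attached to vertex 0. *)
definition pineapple :: "nat \<Rightarrow> nat \<Rightarrow> nat graph" where
  "pineapple n g = ({0..<n}, edges (cycle_graph g) \<union> {{0, i} | i. g \<le> i \<and> i < n})"

definition core_index :: "'a graph \<Rightarrow> nat" where
  "core_index G = card {H. subgraph H G \<and> connected_graph H}"

end

theory Submission
  imports Defs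
begin

text \<open>A unicyclic graph of girth $g$ arises from its cycle by adding pendant vertices one at a
  time. Attaching a pendant vertex $v$ at $u$ creates $1 + f_u$ new connected subgraphs, where $f_u$
  counts those containing $u$. Moreover each $f_w$ at most doubles, and doubles exactly when $w = u$,
  while $f_v = 1 + f_u < 2 f_u$. Hence $f_u \<le> 2^{n-g} f(C_g)$, with equality for $n > g$ only at
  the centre of the pineapple, and summing over the added vertices bounds $F$. The connected
  subgraphs of the cycle itself are the $g^2$ arcs and the whole cycle.\<close>

section \<open>Connectedness and pendant vertices\<close>

text \<open>Unicyclicity is given by an edge count and the girth by a definite description, so
  growth from a cycle has to be derived. Deleting a vertex of degree one preserves |V| = |E|; when
  no such vertex is left, the degree sum 2|E| = 2|V| forces every degree to be 2. Uniqueness of the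
  cycle is carried along the growth, because the description determines the girth only with it. In
  the equality case, extremality of f_u must fix both the graph and the position of u. Hence the
  bound on f_u is proved for all vertices at once, and its equality case yields a copy of the
  pineapple centred at u; equality for F then reduces to equality for f at the last attaching
  vertex. Admitting n = g, where the pineapple is the cycle and every vertex can be its centre,
  gives the inductions their base. The constant 2g + binom(g-1, 2) is g(g+1)/2 + 1: through a vertex
  of C_g pass l+1 arcs with l edges for each l < g, and the whole cycle.\<close>

lemma connected_graph_iff_closed:
  "connected_graph G \<longleftrightarrow> simple_graph G \<and> verts G \<noteq> {} \<and>
     (\<forall>S. S \<subseteq> verts G \<longrightarrow> S \<noteq> {} \<longrightarrow> (\<forall>e\<in>edges G. e \<inter> S \<noteq> {} \<longrightarrow> e \<subseteq> S) \<longrightarrow> S = verts G)"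
    (is "_ \<longleftrightarrow> _ \<and> _ \<and> ?C")
proof (intro iffI conjI)
  assume con: "connected_graph G"
  then show "simple_graph G" "verts G \<noteq> {}" by (auto simp: connected_graph_def)
  show ?C
  proof (intro allI impI)
    fix S assume S: "S \<subseteq> verts G" "S \<noteq> {}" and cl: "\<forall>e\<in>edges G. e \<inter> S \<noteq> {} \<longrightarrow> e \<subseteq> S"
    then obtain x where x: "x \<in> S" by blast
    have "y \<in> S" if "y \<in> verts G" for y
    proof -
      have "(x, y) \<in> (adj_rel G)\<^sup>*"
        using con that x S by (auto simp: connected_graph_def)
      then show ?thesis
      proof (induction rule: rtrancl_induct)
        case base
        show ?case by (rule x)
      next
        case (step y z)
        then have "{y, z} \<in> edges G" by (simp add: adj_rel_def)
        moreover have "{y, z} \<inter> S \<noteq> {}" using step.IH by simp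
        ultimately have "{y, z} \<subseteq> S" using cl by metis
        then show ?case by simp
      qed
    qed
    with S show "S = verts G" by blast
  qed
next
  assume H: "simple_graph G \<and> verts G \<noteq> {} \<and> ?C"
  then have sG: "simple_graph G" and C: ?C by simp_all
  have "(u, v) \<in> (adj_rel G)\<^sup>*" if u: "u \<in> verts G" and v: "v \<in> verts G" for u v
  proof -
    \<comment> \<open>The set reachable from \<open>u\<close> is closed under edges, so by
      hypothesis it is everything.\<close>
    define S where "S = {w \<in> verts G. (u, w) \<in> (adj_rel G)\<^sup>*}"
    have "e \<subseteq> S" if e: "e \<in> edges G" "e \<inter> S \<noteq> {}" for e
    proof
      fix z assume z: "z \<in> e"
      from e obtain w where w: "w \<in> e" "w \<in> S" by blast
      have e2: "e \<subseteq> verts G" "card e = 2" using sG e by (auto simp: simple_graph_def)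
      show "z \<in> S"
      proof (cases "z = w")
        case False
        with e2 z w have "e = {w, z}" by (auto simp: card_2_iff)
        then have "(w, z) \<in> adj_rel G" using e by (simp add: adj_rel_def)
        with w have "(u, z) \<in> (adj_rel G)\<^sup>*"
          unfolding S_def by (blast intro: rtrancl_into_rtrancl)
        with z e2 show ?thesis unfolding S_def by blast
      qed (use w in simp)
    qed
    moreover have "S \<subseteq> verts G" "u \<in> S" using u by (auto simp: S_def)
    ultimately have "S = verts G" using C by (metis empty_iff)
    with v show ?thesis by (auto simp: S_def)
  qed
  with H show "connected_graph G" unfolding connected_graph_def by blast
qed

text \<open>Connectedness is used and established through sets that no edge leaves. When a vertex or
  an edge is added or deleted, such a set is adjusted by a single vertex, whereas walks would need
  an induction each time.\<close>

lemma connected_closed_eq: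
  assumes "connected_graph G" "S \<subseteq> verts G" "S \<noteq> {}"
    and "\<And>e. e \<in> edges G \<Longrightarrow> e \<inter> S \<noteq> {} \<Longrightarrow> e \<subseteq> S"
  shows "S = verts G"
proof -
  have "\<forall>S. S \<subseteq> verts G \<longrightarrow> S \<noteq> {} \<longrightarrow> (\<forall>e\<in>edges G. e \<inter> S \<noteq> {} \<longrightarrow> e \<subseteq> S) \<longrightarrow> S = verts G"
    using assms(1) unfolding connected_graph_iff_closed by (elim conjE)
  with assms(2-4) show ?thesis by simp
qed

lemma connectedI_closed:
  assumes "simple_graph G" "verts G \<noteq> {}"
    and "\<And>S. S \<subseteq> verts G \<Longrightarrow> S \<noteq> {} \<Longrightarrow> (\<And>e. e \<in> edges G \<Longrightarrow> e \<inter> S \<noteq> {} \<Longrightarrow> e \<subseteq> S)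
      \<Longrightarrow> verts G \<subseteq> S"
  shows "connected_graph G"
  unfolding connected_graph_iff_closed
proof (intro conjI allI impI assms(1,2))
  fix S assume S: "S \<subseteq> verts G" "S \<noteq> {}" "\<forall>e\<in>edges G. e \<inter> S \<noteq> {} \<longrightarrow> e \<subseteq> S"
  then have "verts G \<subseteq> S" by (intro assms(3)) auto
  with S(1) show "S = verts G" by (rule subset_antisym)
qed

lemma connected_imp_simple: "connected_graph G \<Longrightarrow> simple_graph G"
  by (simp add: connected_graph_def)

lemma simple_edgeD:
  "simple_graph G \<Longrightarrow> e \<in> edges G \<Longrightarrow> e \<subseteq> verts G"
  "simple_graph G \<Longrightarrow> e \<in> edges G \<Longrightarrow> card e = 2"
  by (auto simp: simple_graph_def)

lemma simple_finite:
  assumes "simple_graph G"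
  shows "finite (verts G)" "finite (edges G)"
proof -
  show "finite (verts G)" using assms by (simp add: simple_graph_def)
  then have "finite (Pow (verts G))" by simp
  moreover have "edges G \<subseteq> Pow (verts G)" using assms by (auto simp: simple_graph_def)
  ultimately show "finite (edges G)" by (rule finite_subset[rotated])
qed

lemma simple_edge_at:
  assumes "simple_graph G" "e \<in> edges G" "x \<in> e"
  obtains y where "y \<noteq> x" "y \<in> verts G" "e = {x, y}"
proof -
  have "card e = 2" "e \<subseteq> verts G" using assms by (auto simp: simple_graph_def)
  then obtain a b where ab: "e = {a, b}" "a \<noteq> b" by (auto simp: card_2_iff)
  with assms(3) consider "x = a" | "x = b" by blast
  then show thesis
  proof cases
    case 1
    with ab \<open>e \<subseteq> verts G\<close> show thesis by (intro that[of b]) auto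
  next
    case 2
    with ab \<open>e \<subseteq> verts G\<close> show thesis by (intro that[of a]) auto
  qed
qed

section \<open>Attaching and deleting a pendant vertex\<close>

definition add_leaf :: "'a \<Rightarrow> 'a \<Rightarrow> 'a graph \<Rightarrow> 'a graph" where
  "add_leaf u v G = (insert v (verts G), insert {u, v} (edges G))"

lemma verts_add_leaf [simp]: "verts (add_leaf u v G) = insert v (verts G)"
  and edges_add_leaf [simp]: "edges (add_leaf u v G) = insert {u, v} (edges G)"
  by (simp_all add: add_leaf_def)

lemma simple_add_leaf:
  assumes "simple_graph G" "u \<in> verts G" "v \<notin> verts G"
  shows "simple_graph (add_leaf u v G)"
proof -
  have "u \<noteq> v" using assms by blast
  then show ?thesis using assms by (auto simp: simple_graph_def)
qed

lemma connected_add_leaf: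
  assumes "connected_graph G" "u \<in> verts G" "v \<notin> verts G"
  shows "connected_graph (add_leaf u v G)"
proof (rule connectedI_closed)
  show "simple_graph (add_leaf u v G)"
    using assms by (simp add: simple_add_leaf connected_imp_simple)
  show "verts (add_leaf u v G) \<noteq> {}" by simp
  fix S assume S: "S \<subseteq> verts (add_leaf u v G)" "S \<noteq> {}"
    and cl: "\<And>e. e \<in> edges (add_leaf u v G) \<Longrightarrow> e \<inter> S \<noteq> {} \<Longrightarrow> e \<subseteq> S"
  \<comment> \<open>The pendant edge puts both of its ends into a closed set or neither, so
    \<open>S\<close> meets \<open>verts G\<close> and its trace there is closed in
    \<open>G\<close>.\<close>
  have uv: "u \<in> S \<longleftrightarrow> v \<in> S" using cl[of "{u, v}"] by auto
  have "S \<inter> verts G \<noteq> {}" using S uv assms(2) by auto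
  moreover have "e \<subseteq> S \<inter> verts G" if "e \<in> edges G" "e \<inter> (S \<inter> verts G) \<noteq> {}" for e
    using cl[of e] that simple_edgeD(1)[OF connected_imp_simple[OF assms(1)]] by auto
  ultimately have "S \<inter> verts G = verts G"
    using connected_closed_eq[OF assms(1), of "S \<inter> verts G"] by blast
  with uv assms(2) show "verts (add_leaf u v G) \<subseteq> S" by auto
qed

text \<open>A closed set of the graph without \<open>v\<close> becomes closed in \<open>H\<close> by
  adding \<open>v\<close> if it contains \<open>u\<close>, and is already closed in \<open>H\<close>
  otherwise. The second case is absurd: the set would be all of \<open>verts H\<close> while missing
  \<open>v\<close>.\<close>

lemma connected_remove_leaf:
  assumes con: "connected_graph H" and v: "v \<in> verts H" and u: "u \<noteq> v"
    and uv: "{u, v} \<in> edges H" and leaf: "\<And>e. e \<in> edges H \<Longrightarrow> v \<in> e \<Longrightarrow> e = {u, v}"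
  obtains K where "connected_graph K" "u \<in> verts K" "v \<notin> verts K" "H = add_leaf u v K"
proof -
  define K where "K = (verts H - {v}, edges H - {{u, v}})"
  have sH: "simple_graph H" using con by (rule connected_imp_simple)
  have sK: "simple_graph K"
    using sH leaf by (force simp: simple_graph_def K_def)
  have uK: "u \<in> verts K" using simple_edgeD(1)[OF sH uv] u by (auto simp: K_def)
  have "connected_graph K"
  proof (rule connectedI_closed[OF sK])
    show "verts K \<noteq> {}" using uK by blast
    fix S assume S: "S \<subseteq> verts K" "S \<noteq> {}"
      and cl: "\<And>e. e \<in> edges K \<Longrightarrow> e \<inter> S \<noteq> {} \<Longrightarrow> e \<subseteq> S"
    show "verts K \<subseteq> S"
    proof (cases "u \<in> S")
      case True
      have "e \<subseteq> insert v S" if "e \<in> edges H" "e \<inter> insert v S \<noteq> {}" for e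
      proof (cases "e = {u, v}")
        case False
        then have "v \<notin> e" using leaf that by blast
        then have "e \<subseteq> S" using cl[of e] that False by (auto simp: K_def)
        then show ?thesis by blast
      qed (use True in auto)
      moreover have "insert v S \<subseteq> verts H" using S v by (auto simp: K_def)
      ultimately have "insert v S = verts H"
        using connected_closed_eq[OF con] by blast
      then show ?thesis by (auto simp: K_def)
    next
      case False
      have vS: "v \<notin> S" using S by (auto simp: K_def)
      have "e \<subseteq> S" if "e \<in> edges H" "e \<inter> S \<noteq> {}" for e
        using cl[of e] that False vS by (auto simp: K_def)
      moreover have "S \<subseteq> verts H" using S by (auto simp: K_def)
      ultimately have "S = verts H" using connected_closed_eq[OF con] S(2) by blast
      with v vS show ?thesis by blast
    qed
  qed
  moreover have "H = add_leaf u v K"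
    using v uv by (auto simp: add_leaf_def K_def prod_eq_iff)
  moreover have "v \<notin> verts K" by (simp add: K_def)
  ultimately show thesis using that uK by blast
qed

lemma connected_singleton: "connected_graph ({v}, {})"
  by (auto simp: connected_graph_def simple_graph_def)

section \<open>Counting connected subgraphs\<close>

definition conn_subgraphs :: "'a graph \<Rightarrow> 'a graph set" where
  "conn_subgraphs G = {H. subgraph H G \<and> connected_graph H}"

text \<open>This is the number f_u of the overview.\<close>

definition rooted_index :: "'a \<Rightarrow> 'a graph \<Rightarrow> nat" where
  "rooted_index u G = card {H \<in> conn_subgraphs G. u \<in> verts H}"

lemma core_index_conn_subgraphs: "core_index G = card (conn_subgraphs G)"
  by (simp add: core_index_def conn_subgraphs_def)

lemma finite_conn_subgraphs:
  assumes "simple_graph G"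
  shows "finite (conn_subgraphs G)"
proof (rule finite_subset)
  show "conn_subgraphs G \<subseteq> Pow (verts G) \<times> Pow (edges G)"
    by (auto simp: conn_subgraphs_def subgraph_def)
  show "finite (Pow (verts G) \<times> Pow (edges G))" using simple_finite[OF assms] by simp
qed

lemma singleton_conn_subgraph: "v \<in> verts G \<Longrightarrow> ({v}, {}) \<in> conn_subgraphs G"
  by (auto simp: conn_subgraphs_def subgraph_def connected_singleton connected_imp_simple)

text \<open>A connected subgraph that uses the pendant edge contains \<open>u\<close> and stays
  connected when \<open>v\<close> is deleted. One that contains \<open>v\<close> without this edge
  has \<open>v\<close> isolated, hence is the single vertex. All others live in
  \<open>G\<close>.\<close>

lemma conn_subgraphs_add_leaf:
  assumes sG: "simple_graph G" and u: "u \<in> verts G" and v: "v \<notin> verts G"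
  shows "conn_subgraphs (add_leaf u v G) =
    conn_subgraphs G \<union> {({v}, {})} \<union> add_leaf u v ` {H \<in> conn_subgraphs G. u \<in> verts H}"
    (is "?L = ?R")
proof
  have uv: "u \<noteq> v" using u v by blast
  show "?L \<subseteq> ?R"
  proof
    fix H assume "H \<in> ?L"
    then have con: "connected_graph H" and sH: "simple_graph H"
      and V: "verts H \<subseteq> insert v (verts G)" and E: "edges H \<subseteq> insert {u, v} (edges G)"
      by (auto simp: conn_subgraphs_def subgraph_def)
    have leaf: "e = {u, v}" if "e \<in> edges H" "v \<in> e" for e
      using that E v simple_edgeD(1)[OF sG] by blast
    show "H \<in> ?R"
    proof (cases "{u, v} \<in> edges H")
      case True
      have vH: "v \<in> verts H" using simple_edgeD(1)[OF sH True] by simp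
      obtain K where K: "connected_graph K" "u \<in> verts K" "v \<notin> verts K" "H = add_leaf u v K"
        using connected_remove_leaf[OF con vH uv True leaf] by blast
      have "{u, v} \<notin> edges K"
        using K simple_edgeD(1)[OF connected_imp_simple[OF K(1)]] by blast
      then have "K \<in> conn_subgraphs G"
        using K V E by (auto simp: conn_subgraphs_def subgraph_def connected_imp_simple)
      with K show ?thesis by blast
    next
      case False
      show ?thesis
      proof (cases "v \<in> verts H")
        case True
        \<comment> \<open>No edge of \<open>H\<close> meets \<open>v\<close>, so \<open>{v}\<close>
          is closed and exhausts \<open>H\<close>.\<close>
        have "e \<subseteq> {v}" if "e \<in> edges H" "e \<inter> {v} \<noteq> {}" for e
          using leaf that False by blast
        then have "{v} = verts H" using connected_closed_eq[OF con, of "{v}"] True by blast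
        moreover have "edges H = {}"
        proof -
          have "v \<in> e" if "e \<in> edges H" for e
            using simple_edgeD[OF sH that] \<open>{v} = verts H\<close> by (auto simp: card_2_iff)
          then show ?thesis using leaf False by blast
        qed
        ultimately have "H = ({v}, {})" by (simp add: prod_eq_iff)
        then show ?thesis by simp
      next
        case vH: False
        have "H \<in> conn_subgraphs G"
          using con sH V E False vH by (auto simp: conn_subgraphs_def subgraph_def)
        then show ?thesis by simp
      qed
    qed
  qed
  show "?R \<subseteq> ?L"
  proof (intro Un_least subsetI)
    fix H assume "H \<in> conn_subgraphs G"
    then show "H \<in> ?L" by (auto simp: conn_subgraphs_def subgraph_def)
  next
    fix H :: "'a graph" assume "H \<in> {({v}, {})}"
    then show "H \<in> ?L" using singleton_conn_subgraph[of v "add_leaf u v G"] by simp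
  next
    fix H assume "H \<in> add_leaf u v ` {H \<in> conn_subgraphs G. u \<in> verts H}"
    then obtain K where K: "K \<in> conn_subgraphs G" "u \<in> verts K" "H = add_leaf u v K" by blast
    then have "v \<notin> verts K" using v by (auto simp: conn_subgraphs_def subgraph_def)
    then have "connected_graph H"
      using K by (simp add: connected_add_leaf conn_subgraphs_def)
    with K show "H \<in> ?L"
      by (auto simp: conn_subgraphs_def subgraph_def connected_imp_simple)
  qed
qed

lemma conn_subgraphs_not_in:
  "v \<notin> verts G \<Longrightarrow> H \<in> conn_subgraphs G \<Longrightarrow> v \<notin> verts H"
  by (auto simp: conn_subgraphs_def subgraph_def)

text \<open>Members of \<open>conn_subgraphs G\<close> contain neither \<open>v\<close> nor the
  pendant edge, so deleting both recovers the original.\<close>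

lemma inj_on_add_leaf:
  assumes v: "v \<notin> verts G"
  shows "inj_on (add_leaf u v) (conn_subgraphs G)"
proof (rule inj_onI)
  fix H K assume H: "H \<in> conn_subgraphs G" and K: "K \<in> conn_subgraphs G"
    and eq: "add_leaf u v H = add_leaf u v K"
  have *: "v \<notin> verts L \<and> {u, v} \<notin> edges L" if "L \<in> conn_subgraphs G" for L
    using that v simple_edgeD(1)[of L "{u, v}"]
    by (auto simp: conn_subgraphs_def subgraph_def)
  from eq have "insert v (verts H) = insert v (verts K)"
    "insert {u, v} (edges H) = insert {u, v} (edges K)"
    by (simp_all add: add_leaf_def)
  with *[OF H] *[OF K] show "H = K"
    by (simp add: prod_eq_iff insert_ident)
qed

lemma core_index_add_leaf:
  assumes "simple_graph G" and u: "u \<in> verts G" and v: "v \<notin> verts G"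
  shows "core_index (add_leaf u v G) = core_index G + 1 + rooted_index u G"
proof -
  let ?A = "conn_subgraphs G" and ?B = "{({v}, {}) :: 'a graph}"
  let ?R = "{H \<in> conn_subgraphs G. u \<in> verts H}"
  have fin: "finite ?A" by (rule finite_conn_subgraphs[OF assms(1)])
  have "card (?A \<union> ?B \<union> add_leaf u v ` ?R) = card (?A \<union> ?B) + card (add_leaf u v ` ?R)"
  proof (rule card_Un_disjoint)
    show "(?A \<union> ?B) \<inter> add_leaf u v ` ?R = {}"
    proof -
      \<comment> \<open>The vertex \<open>v\<close> separates the images from the subgraphs of
        \<open>G\<close>, and the presence of an edge separates them from the single vertex.\<close>
      have "v \<notin> verts H" if "H \<in> ?A" for H using conn_subgraphs_not_in[OF v that] .
      moreover have "v \<in> verts H \<and> edges H \<noteq> {}" if "H \<in> add_leaf u v ` ?R" for H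
        using that by auto
      ultimately show ?thesis by (metis (no_types, lifting) Int_emptyI Un_iff singletonD snd_conv)
    qed
  qed (use fin in auto)
  also have "card (?A \<union> ?B) = card ?A + 1"
    using fin conn_subgraphs_not_in[OF v, of "({v}, {})"] by (simp add: card_insert_if) auto
  also have "card (add_leaf u v ` ?R) = card ?R"
    by (rule card_image) (rule inj_on_subset[OF inj_on_add_leaf[OF v]], blast)
  finally show ?thesis
    using conn_subgraphs_add_leaf[OF assms]
    by (simp add: core_index_conn_subgraphs rooted_index_def)
qed

lemma rooted_index_leaf:
  assumes "simple_graph G" and u: "u \<in> verts G" and v: "v \<notin> verts G"
  shows "rooted_index v (add_leaf u v G) = 1 + rooted_index u G"
proof -
  let ?R = "{H \<in> conn_subgraphs G. u \<in> verts H}"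
  have "{H \<in> conn_subgraphs (add_leaf u v G). v \<in> verts H} = {({v}, {})} \<union> add_leaf u v ` ?R"
    using conn_subgraphs_not_in[OF v] unfolding conn_subgraphs_add_leaf[OF assms] by auto
  moreover have "card ({({v}, {})} \<union> add_leaf u v ` ?R) = card {({v}, {}) :: 'a graph} + card (add_leaf u v ` ?R)"
    using finite_conn_subgraphs[OF assms(1)] by (intro card_Un_disjoint) (auto simp: add_leaf_def)
  moreover have "card (add_leaf u v ` ?R) = card ?R"
    by (rule card_image) (rule inj_on_subset[OF inj_on_add_leaf[OF v]], blast)
  ultimately show ?thesis by (simp add: rooted_index_def)
qed

lemma rooted_index_add_leaf:
  assumes "simple_graph G" and u: "u \<in> verts G" and v: "v \<notin> verts G" and w: "w \<in> verts G"
  shows "rooted_index w (add_leaf u v G) =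
    rooted_index w G + card {H \<in> conn_subgraphs G. u \<in> verts H \<and> w \<in> verts H}"
proof -
  let ?R = "{H \<in> conn_subgraphs G. u \<in> verts H \<and> w \<in> verts H}"
  let ?A = "{H \<in> conn_subgraphs G. w \<in> verts H}"
  have wv: "w \<noteq> v" using v w by blast
  have "{H \<in> conn_subgraphs (add_leaf u v G). w \<in> verts H} = ?A \<union> add_leaf u v ` ?R"
    using wv unfolding conn_subgraphs_add_leaf[OF assms(1-3)] by auto
  moreover have "card (?A \<union> add_leaf u v ` ?R) = card ?A + card (add_leaf u v ` ?R)"
  proof (rule card_Un_disjoint)
    have "v \<notin> verts H" if "H \<in> ?A" for H using conn_subgraphs_not_in[OF v] that by blast
    moreover have "v \<in> verts H" if "H \<in> add_leaf u v ` ?R" for H using that by auto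
    ultimately show "?A \<inter> add_leaf u v ` ?R = {}" by (metis (no_types, lifting) Int_emptyI)
  qed (use finite_conn_subgraphs[OF assms(1)] in auto)
  moreover have "card (add_leaf u v ` ?R) = card ?R"
    by (rule card_image) (rule inj_on_subset[OF inj_on_add_leaf[OF v]], blast)
  ultimately show ?thesis by (simp add: rooted_index_def)
qed

text \<open>The new subgraphs through \<open>w\<close> correspond to those of \<open>G\<close>
  through both \<open>u\<close> and \<open>w\<close>, a subfamily of those through \<open>w\<close>.
  It is the whole family only if it contains the single vertex \<open>w\<close>, which forces
  \<open>u = w\<close>.\<close>

lemma rooted_index_add_leaf_le:
  assumes "simple_graph G" "u \<in> verts G" "v \<notin> verts G" "w \<in> verts G"
  shows "rooted_index w (add_leaf u v G) \<le> 2 * rooted_index w G"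
    and "rooted_index w (add_leaf u v G) = 2 * rooted_index w G \<longleftrightarrow> u = w"
proof -
  let ?R = "{H \<in> conn_subgraphs G. u \<in> verts H \<and> w \<in> verts H}"
  let ?A = "{H \<in> conn_subgraphs G. w \<in> verts H}"
  have fin: "finite ?A" using finite_conn_subgraphs[OF assms(1)] by simp
  have sub: "?R \<subseteq> ?A" by blast
  have le: "card ?R \<le> card ?A" by (rule card_mono[OF fin sub])
  then show "rooted_index w (add_leaf u v G) \<le> 2 * rooted_index w G"
    using rooted_index_add_leaf[OF assms] by (simp add: rooted_index_def)
  have "card ?R = card ?A \<longleftrightarrow> u = w"
  proof
    assume "card ?R = card ?A"
    then have "?R = ?A" by (rule card_subset_eq[OF fin sub])
    moreover have "({w}, {}) \<in> ?A" using singleton_conn_subgraph[OF assms(4)] by simp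
    ultimately have "({w}, {}) \<in> ?R" by blast
    then show "u = w" by simp
  qed simp
  then show "rooted_index w (add_leaf u v G) = 2 * rooted_index w G \<longleftrightarrow> u = w"
    using rooted_index_add_leaf[OF assms] by (simp add: rooted_index_def)
qed

section \<open>Connected subgraphs of a cycle\<close>

text \<open>The cycle is labelled by all integers with period \<open>g\<close> instead of by
  residues. Successors and predecessors are then plain \<open>i + 1\<close> and
  \<open>i - 1\<close>, any vertex can serve as origin, and wrap-around becomes divisibility by
  \<open>g\<close>.\<close>

locale cyclic_labelling =
  fixes c :: "int \<Rightarrow> 'a" and g :: nat
  assumes g3: "3 \<le> g" and c_eq_iff: "c i = c j \<longleftrightarrow> int g dvd i - j"
begin

definition cedge :: "int \<Rightarrow> 'a set" where
  "cedge i = {c i, c (i + 1)}"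

definition cyc :: "'a graph" where
  "cyc = (range c, range cedge)"

text \<open>The parameter \<open>l\<close> counts edges, so there are \<open>l + 1\<close> listed
  vertices. For \<open>l < g\<close> they are distinct and the arc is a path;
  \<open>l = g - 1\<close> gives the cycle with one edge removed, and \<open>l = g\<close> would
  give the cycle itself.\<close>

definition arc :: "int \<Rightarrow> nat \<Rightarrow> 'a graph" where
  "arc i l = ((\<lambda>j. c (i + int j)) ` {..l}, (\<lambda>j. cedge (i + int j)) ` {..<l})"

lemma small_dvd: "int g dvd k \<Longrightarrow> \<bar>k\<bar> < int g \<Longrightarrow> k = 0"
  using dvd_imp_le_int[of k "int g"] by force

lemma cedge_eq_iff: "cedge i = cedge j \<longleftrightarrow> int g dvd i - j"
proof
  assume "cedge i = cedge j"
  then consider "c i = c j" | "c i = c (j + 1)" "c (i + 1) = c j"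
    by (auto simp: cedge_def doubleton_eq_iff)
  then show "int g dvd i - j"
  proof cases
    \<comment> \<open>Matching the two edges in opposite directions would give g | 2, which g >= 3
      excludes.\<close>
    case 2
    then have "int g dvd i - (j + 1)" "int g dvd i + 1 - j" by (simp_all add: c_eq_iff)
    then have "int g dvd (i + 1 - j) - (i - (j + 1))" by (metis dvd_diff)
    then show ?thesis using small_dvd[of 2] g3 by simp
  qed (simp add: c_eq_iff)
next
  assume "int g dvd i - j"
  then have "c i = c j" "c (i + 1) = c (j + 1)" by (simp_all add: c_eq_iff)
  then show "cedge i = cedge j" by (simp add: cedge_def)
qed

lemma card_cedge: "card (cedge i) = 2"
  using c_eq_iff[of i "i + 1"] small_dvd[of "-1"] g3 by (auto simp: cedge_def)

lemma cedges_at: "{e \<in> range cedge. c i \<in> e} = {cedge (i - 1), cedge i}"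
proof (intro subset_antisym subsetI)
  fix e assume "e \<in> {e \<in> range cedge. c i \<in> e}"
  then obtain k where k: "e = cedge k" "c i = c k \<or> c i = c (k + 1)" by (auto simp: cedge_def)
  then show "e \<in> {cedge (i - 1), cedge i}"
    by (auto simp: c_eq_iff cedge_eq_iff dvd_diff_commute algebra_simps)
qed (auto simp: cedge_def)

lemma card_cedges_at: "card {e \<in> range cedge. c i \<in> e} = 2"
  unfolding cedges_at using small_dvd[of "-1"] g3 by (simp add: cedge_eq_iff)

lemma range_eq_image:
  assumes "\<And>i j. int g dvd i - j \<Longrightarrow> f i = f j"
  shows "range f = (\<lambda>j. f (i + int j)) ` {..<g}"
proof (intro subset_antisym subsetI)
  fix y assume "y \<in> range f"
  then obtain k where k: "y = f k" by blast
  define j where "j = nat ((k - i) mod int g)"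
  have "(k - i) mod int g < int g" "0 \<le> (k - i) mod int g" using g3 by auto
  then have "j < g" "int j = (k - i) mod int g" by (auto simp: j_def nat_less_iff)
  moreover have "f k = f (i + int j)"
    using calculation mod_eq_dvd_iff[of "k - i" "int g" "int j"]
    by (intro assms) (simp add: algebra_simps)
  ultimately show "y \<in> (\<lambda>j. f (i + int j)) ` {..<g}" using k by blast
qed auto

lemma range_c: "range c = (\<lambda>j. c (i + int j)) ` {..<g}"
  by (rule range_eq_image) (simp add: c_eq_iff)

lemma range_cedge: "range cedge = (\<lambda>j. cedge (i + int j)) ` {..<g}"
  by (rule range_eq_image) (simp add: cedge_eq_iff)

lemma inj_on_shift:
  assumes "A \<subseteq> {..<g}"
  shows "inj_on (\<lambda>j. c (i + int j)) A" "inj_on (\<lambda>j. cedge (i + int j)) A"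
proof -
  have "int g dvd (i + int j) - (i + int k) \<longleftrightarrow> j = k" if "j \<in> A" "k \<in> A" for j k
  proof -
    have "j < g" "k < g" using that assms by blast+
    then have "\<bar>int j - int k\<bar> < int g" by linarith
    then show ?thesis using small_dvd[of "int j - int k"] by auto
  qed
  then show "inj_on (\<lambda>j. c (i + int j)) A" "inj_on (\<lambda>j. cedge (i + int j)) A"
    by (auto simp: inj_on_def c_eq_iff cedge_eq_iff)
qed

lemma card_cyc: "card (verts cyc) = g" "card (edges cyc) = g"
  using card_image[OF inj_on_shift(1)[of "{..<g}" 0]] card_image[OF inj_on_shift(2)[of "{..<g}" 0]]
    range_c[of 0] range_cedge[of 0] by (simp_all add: cyc_def)

lemma simple_cyc: "simple_graph cyc"
  using range_c[of 0] by (auto simp: simple_graph_def cyc_def card_cedge) (auto simp: cedge_def)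

text \<open>Forward steps suffice, since \<open>g\<close> consecutive labels already cover the
  cycle.\<close>

lemma closed_range:
  assumes "c k \<in> S" and step: "\<And>i. c i \<in> S \<Longrightarrow> c (i + 1) \<in> S"
  shows "range c \<subseteq> S"
proof -
  have "c (k + int j) \<in> S" for j
  proof (induction j)
    case (Suc j)
    then show ?case using step[of "k + int j"] by (simp add: algebra_simps)
  qed (use assms in simp)
  then show ?thesis unfolding range_c[of k] by blast
qed

lemma connected_cyc: "connected_graph cyc"
proof (rule connectedI_closed[OF simple_cyc])
  show "verts cyc \<noteq> {}" by (simp add: cyc_def)
  fix S assume S: "S \<subseteq> verts cyc" "S \<noteq> {}"
    and cl: "\<And>e. e \<in> edges cyc \<Longrightarrow> e \<inter> S \<noteq> {} \<Longrightarrow> e \<subseteq> S"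
  obtain x where "x \<in> S" using S(2) by blast
  then obtain k where "c k \<in> S" using S(1) by (auto simp: cyc_def)
  then show "verts cyc \<subseteq> S"
  proof (simp add: cyc_def, rule closed_range)
    show "c (i + 1) \<in> S" if "c i \<in> S" for i
      using cl[of "cedge i"] that by (auto simp: cyc_def cedge_def)
  qed
qed

text \<open>An arc grows by appending a pendant vertex at its last end; the length bound keeps the
  new end distinct from the earlier vertices.\<close>

lemma connected_arc: "l < g \<Longrightarrow> connected_graph (arc i l)"
proof (induction l)
  case 0
  show ?case by (simp add: arc_def connected_singleton)
next
  case (Suc l)
  have "c (i + int (Suc l)) \<notin> (\<lambda>j. c (i + int j)) ` {..l}"
  proof
    assume "c (i + int (Suc l)) \<in> (\<lambda>j. c (i + int j)) ` {..l}"
    then obtain j where "j \<le> l" "c (i + int (Suc l)) = c (i + int j)" by blast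
    then show False using small_dvd[of "int (Suc l) - int j"] Suc.prems by (auto simp: c_eq_iff)
  qed
  moreover have "arc i (Suc l) = add_leaf (c (i + int l)) (c (i + int (Suc l))) (arc i l)"
    by (simp add: arc_def add_leaf_def atMost_Suc lessThan_Suc cedge_def algebra_simps)
  ultimately show ?case using Suc by (auto simp: arc_def intro!: connected_add_leaf)
qed

lemma arc_in_conn_subgraphs: "l < g \<Longrightarrow> arc i l \<in> conn_subgraphs cyc"
  using connected_arc[of l i] connected_imp_simple[of "arc i l"]
  by (auto simp: conn_subgraphs_def subgraph_def cyc_def arc_def)

lemma arc_cong: "int g dvd i - i' \<Longrightarrow> arc i l = arc i' l"
proof -
  assume *: "int g dvd i - i'"
  have "c (i + int j) = c (i' + int j)" "cedge (i + int j) = cedge (i' + int j)" for j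
    using * by (auto simp: c_eq_iff cedge_eq_iff)
  then show ?thesis by (simp add: arc_def)
qed

text \<open>This marks the start of an arc intrinsically. It allows the start to be read off from
  the arc and tells arcs from the whole cycle.\<close>

lemma prev_edge_notin_arc: "l < g \<Longrightarrow> cedge (i - 1) \<notin> edges (arc i l)"
proof
  assume l: "l < g" and "cedge (i - 1) \<in> edges (arc i l)"
  then obtain j where "j < l" "int g dvd (i - 1) - (i + int j)"
    by (auto simp: arc_def cedge_eq_iff)
  then show False using small_dvd[of "- 1 - int j"] l by auto
qed

text \<open>The vertex count determines \<open>l\<close>. If \<open>i\<close> sat at a positive
  offset in the arc from \<open>i'\<close>, the edge just before \<open>i\<close> would belong to
  that arc, contradicting that \<open>i\<close> is a start.\<close>

lemma arc_eq_iff: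
  assumes "l < g" "l' < g"
  shows "arc i l = arc i' l' \<longleftrightarrow> l = l' \<and> int g dvd i - i'"
proof
  assume eq: "arc i l = arc i' l'"
  have "card (verts (arc i l)) = Suc l" if "l < g" for i l
  proof -
    have "{..l} \<subseteq> {..<g}" using that by auto
    then show ?thesis using inj_on_shift(1)[of "{..l}" i] by (simp add: arc_def card_image)
  qed
  with eq assms have "l = l'" by (metis Suc_inject)
  have "c i \<in> verts (arc i l)" by (auto simp: arc_def image_iff intro: bexI[of _ 0])
  then obtain a where a: "a \<le> l" "int g dvd i - (i' + int a)"
    unfolding eq \<open>l = l'\<close>[symmetric] by (auto simp: arc_def c_eq_iff)
  have "a = 0"
  proof (rule ccontr)
    assume "a \<noteq> 0"
    then have "cedge (i - 1) = cedge (i' + int (a - 1))"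
      using a by (simp add: cedge_eq_iff of_nat_diff algebra_simps)
    moreover have "a - 1 < l" using a \<open>a \<noteq> 0\<close> by simp
    ultimately have "cedge (i - 1) \<in> edges (arc i' l')"
      using \<open>l = l'\<close> by (auto simp: arc_def)
    then show False using prev_edge_notin_arc[OF assms(1), of i] eq by simp
  qed
  with a \<open>l = l'\<close> show "l = l' \<and> int g dvd i - i'" by simp
qed (simp add: arc_cong)

text \<open>Take a vertex of \<open>H\<close> whose preceding edge is missing and follow the cycle
  forward to the first missing edge. No edge of \<open>H\<close> leaves the arc traversed, so
  connectedness makes it all of \<open>H\<close>.\<close>

lemma conn_subgraph_is_arc:
  assumes H: "H \<in> conn_subgraphs cyc" and ne: "H \<noteq> cyc"
  obtains i l where "l < g" "H = arc i l"
proof -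
  have con: "connected_graph H" and sH: "simple_graph H"
    and V: "verts H \<subseteq> range c" and E: "edges H \<subseteq> range cedge"
    using H by (auto simp: conn_subgraphs_def subgraph_def cyc_def)
  \<comment> \<open>If every vertex had its preceding edge, walking backwards would collect all
    vertices and edges, and \<open>H\<close> would be the cycle.\<close>
  have "\<exists>i. c i \<in> verts H \<and> cedge (i - 1) \<notin> edges H"
  proof (rule ccontr)
    assume "\<not> ?thesis"
    then have *: "cedge (i - 1) \<in> edges H" if "c i \<in> verts H" for i using that by blast
    have pred: "c (i - 1) \<in> verts H" if "c i \<in> verts H" for i
      using simple_edgeD(1)[OF sH *[OF that]] by (simp add: cedge_def)
    obtain x where "x \<in> verts H" using con unfolding connected_graph_def by blast
    with V obtain k where k: "c k \<in> verts H" by blast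
    have "c (k - int j) \<in> verts H" for j
    proof (induction j)
      case (Suc j)
      then show ?case using pred[of "k - int j"] by (simp add: algebra_simps)
    qed (use k in simp)
    moreover have "\<exists>j. c i = c (k - int j)" for i
    proof -
      define j where "j = nat ((k - i) mod int g)"
      have "int j = (k - i) mod int g" using g3 by (simp add: j_def)
      then have "int g dvd i - (k - int j)"
        using mod_eq_dvd_iff[of "int j" "int g" "k - i"] by (simp add: algebra_simps)
      then show ?thesis by (auto simp: c_eq_iff)
    qed
    ultimately have all: "c i \<in> verts H" for i by metis
    have "cedge i \<in> edges H" for i using *[OF all[of "i + 1"]] by simp
    with all V E have "H = cyc" by (auto simp: cyc_def prod_eq_iff)
    with ne show False by contradiction
  qed
  then obtain i where i: "c i \<in> verts H" "cedge (i - 1) \<notin> edges H" by blast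
  define l where "l = (LEAST l. cedge (i + int l) \<notin> edges H)"
  \<comment> \<open>The edge at offset \<open>g - 1\<close> is the one preceding \<open>i\<close>,
    which is missing; hence the least missing offset exists and is below \<open>g\<close>.\<close>
  have last: "cedge (i + int (g - 1)) = cedge (i - 1)"
    using g3 by (simp add: cedge_eq_iff of_nat_diff)
  have l_notin: "cedge (i + int l) \<notin> edges H"
    unfolding l_def by (rule LeastI[of _ "g - 1"]) (use i last in simp)
  have "l \<le> g - 1" unfolding l_def by (rule Least_le) (use i last in simp)
  then have lg: "l < g" using g3 by simp
  have l_in: "cedge (i + int j) \<in> edges H" if "j < l" for j
    using not_less_Least that unfolding l_def by blast
  have sub: "verts (arc i l) \<subseteq> verts H"
  proof
    fix x assume "x \<in> verts (arc i l)"
    then obtain j where j: "j \<le> l" "x = c (i + int j)" by (auto simp: arc_def)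
    show "x \<in> verts H"
    proof (cases j)
      case (Suc m)
      then have "cedge (i + int m) \<subseteq> verts H" using simple_edgeD(1)[OF sH l_in[of m]] j by simp
      then show ?thesis using j Suc by (simp add: cedge_def algebra_simps)
    qed (use i j in simp)
  qed
  \<comment> \<open>Only two cycle edges meet each vertex of the arc, and the two that would leave
    it, before \<open>i\<close> and at offset \<open>l\<close>, are not in \<open>H\<close>.\<close>
  have edge: "e \<in> edges (arc i l)" if e: "e \<in> edges H" "e \<inter> verts (arc i l) \<noteq> {}" for e
  proof -
    obtain j where j: "j \<le> l" "c (i + int j) \<in> e" using e(2) by (auto simp: arc_def)
    then have "e \<in> {cedge (i + int j - 1), cedge (i + int j)}"
      using e(1) E cedges_at by blast
    then consider "e = cedge (i + int j)" | "e = cedge (i + int j - 1)" by blast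
    then show ?thesis
    proof cases
      case 1
      then have "j \<noteq> l" using l_notin e(1) by blast
      then show ?thesis using 1 j by (auto simp: arc_def)
    next
      case 2
      then obtain m where "j = Suc m" using i(2) e(1) by (cases j) auto
      then show ?thesis using 2 j by (auto simp: arc_def)
    qed
  qed
  have arc_sub: "e \<subseteq> verts (arc i l)" if "e \<in> edges (arc i l)" for e
    using simple_edgeD(1)[OF connected_imp_simple[OF connected_arc[OF lg]] that] .
  have "verts (arc i l) = verts H"
  proof (rule connected_closed_eq[OF con sub])
    show "verts (arc i l) \<noteq> {}" by (auto simp: arc_def)
  qed (use edge arc_sub in blast)
  moreover have "edges H = edges (arc i l)"
  proof (intro subset_antisym subsetI)
    fix e assume e: "e \<in> edges H"
    have "e \<noteq> {}" using simple_edgeD(2)[OF sH e] by auto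
    then show "e \<in> edges (arc i l)"
      using edge[OF e] simple_edgeD(1)[OF sH e] \<open>verts (arc i l) = verts H\<close> by blast
  next
    fix e assume "e \<in> edges (arc i l)"
    then show "e \<in> edges H" using l_in by (auto simp: arc_def)
  qed
  ultimately show thesis using that[OF lg, of i] by (simp add: prod_eq_iff)
qed

lemma cyc_in_conn_subgraphs: "cyc \<in> conn_subgraphs cyc"
  using connected_cyc simple_cyc by (simp add: conn_subgraphs_def subgraph_def)

lemma cyc_neq_arc: "l < g \<Longrightarrow> cyc \<noteq> arc i l"
  using prev_edge_notin_arc[of l i] by (metis cyc_def rangeI snd_conv)

lemma core_index_cyc: "core_index cyc = g\<^sup>2 + 1"
proof -
  let ?f = "\<lambda>(j, l). arc (int j) l" and ?D = "{..<g} \<times> {..<g}"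
  have "conn_subgraphs cyc = insert cyc (?f ` ?D)"
  proof (intro subset_antisym subsetI)
    fix H assume H: "H \<in> conn_subgraphs cyc"
    show "H \<in> insert cyc (?f ` ?D)"
    proof (cases "H = cyc")
      case False
      then obtain i l where il: "l < g" "H = arc i l" using conn_subgraph_is_arc[OF H] by blast
      define j where "j = nat (i mod int g)"
      have j: "int j = i mod int g" "j < g" using g3 by (auto simp: j_def nat_less_iff)
      then have "H = arc (int j) l"
        using il by (auto intro!: arc_cong simp: mod_eq_dvd_iff[symmetric])
      then have "H = ?f (j, l)" by simp
      moreover have "(j, l) \<in> ?D" using il j by simp
      ultimately show ?thesis by blast
    qed simp
  qed (auto simp: cyc_in_conn_subgraphs arc_in_conn_subgraphs)
  moreover have "cyc \<notin> ?f ` ?D" using cyc_neq_arc by auto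
  moreover have "card (?f ` ?D) = g * g"
  proof (subst card_image)
    show "inj_on ?f ?D"
    proof (rule inj_onI, clarsimp)
      fix j l j' l' assume *: "arc (int j) l = arc (int j') l'"
        and "j < g" "j' < g" "l < g" "l' < g"
      then show "j = j' \<and> l = l'"
        using small_dvd[of "int j - int j'"] by (auto simp: arc_eq_iff)
    qed
  qed simp
  ultimately show ?thesis by (simp add: core_index_conn_subgraphs power2_eq_square)
qed

text \<open>An arc through \<open>c u\<close> is coded by its number \<open>l\<close> of edges and
  the offset \<open>j\<close> of \<open>c u\<close> from its start. There are \<open>l + 1\<close>
  offsets for each \<open>l < g\<close>, and the cycle adds one more.\<close>

lemma rooted_index_cyc: "rooted_index (c u) cyc = (\<Sum>l<g. Suc l) + 1"
proof -
  let ?f = "\<lambda>(l, j). arc (u - int j) l" and ?D = "SIGMA l:{..<g}. {..l}"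
  have "{H \<in> conn_subgraphs cyc. c u \<in> verts H} = insert cyc (?f ` ?D)"
  proof (intro subset_antisym subsetI)
    fix H assume "H \<in> {H \<in> conn_subgraphs cyc. c u \<in> verts H}"
    then have H: "H \<in> conn_subgraphs cyc" and u: "c u \<in> verts H" by auto
    show "H \<in> insert cyc (?f ` ?D)"
    proof (cases "H = cyc")
      case False
      then obtain i l where il: "l < g" "H = arc i l" using conn_subgraph_is_arc[OF H] by blast
      with u obtain j where j: "j \<le> l" "int g dvd u - (i + int j)"
        by (auto simp: arc_def c_eq_iff)
      then have "H = arc (u - int j) l"
        using il by (auto intro!: arc_cong simp: dvd_diff_commute algebra_simps)
      then have "H = ?f (l, j)" by simp
      moreover have "(l, j) \<in> ?D" using il j by simp
      ultimately show ?thesis by blast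
    qed simp
  next
    fix H assume "H \<in> insert cyc (?f ` ?D)"
    then consider "H = cyc" | l j where "l < g" "j \<le> l" "H = arc (u - int j) l" by auto
    then show "H \<in> {H \<in> conn_subgraphs cyc. c u \<in> verts H}"
    proof cases
      case 1
      then show ?thesis using cyc_in_conn_subgraphs by (simp add: cyc_def)
    next
      case 2
      then have "c u \<in> verts H" by (auto simp: arc_def intro!: image_eqI[of _ _ j])
      with 2 show ?thesis using arc_in_conn_subgraphs by simp
    qed
  qed
  moreover have "cyc \<notin> ?f ` ?D" using cyc_neq_arc by auto
  moreover have "card (?f ` ?D) = (\<Sum>l<g. Suc l)"
  proof (subst card_image)
    show "inj_on ?f ?D"
    proof (rule inj_onI, clarsimp)
      fix j l j' l' assume *: "arc (u - int j) l = arc (u - int j') l'"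
        and "j \<le> l" "j' \<le> l'" "l < g" "l' < g"
      then show "l = l' \<and> j = j'"
        using small_dvd[of "int j' - int j"] by (auto simp: arc_eq_iff)
    qed
  qed simp
  moreover have "finite (?f ` ?D)" by (intro finite_imageI finite_SigmaI) auto
  ultimately show ?thesis by (simp add: rooted_index_def)
qed

end

section \<open>Isomorphic copies\<close>

text \<open>Copies run from the model into the given graph, so that being a copy is an equality of
  graphs and attaching a leaf can be compared literally on both sides.\<close>

definition image_graph :: "('a \<Rightarrow> 'b) \<Rightarrow> 'a graph \<Rightarrow> 'b graph" where
  "image_graph h P = (h ` verts P, image h ` edges P)"

text \<open>The map \<open>h\<close> is the inverse of the isomorphism. Edges of simple graphs are
  pairs of vertices, so the pairwise condition on adjacency amounts to equality of the edge
  sets.\<close>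

lemma graph_iso_iff_image_graph:
  assumes sG: "simple_graph G" and sP: "simple_graph P"
  shows "graph_iso G P \<longleftrightarrow> (\<exists>h. inj_on h (verts P) \<and> G = image_graph h P)"
proof
  assume "graph_iso G P"
  then obtain f where bij: "bij_betw f (verts G) (verts P)"
    and f: "\<And>u v. u \<in> verts G \<Longrightarrow> v \<in> verts G \<Longrightarrow> {u, v} \<in> edges G \<longleftrightarrow> {f u, f v} \<in> edges P"
    unfolding graph_iso_def by blast
  define h where "h = inv_into (verts G) f"
  have hf: "h (f x) = x" if "x \<in> verts G" for x
    using bij that by (simp add: h_def bij_betw_inv_into_left)
  have fh: "f (h y) = y" "h y \<in> verts G" if "y \<in> verts P" for y
    using bij that bij_betwE[OF bij_betw_inv_into[OF bij]]
    by (auto simp: h_def bij_betw_inv_into_right)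
  have bh: "bij_betw h (verts P) (verts G)" unfolding h_def by (rule bij_betw_inv_into[OF bij])
  have "edges G = image h ` edges P"
  proof (intro subset_antisym subsetI)
    fix e assume e: "e \<in> edges G"
    then obtain u v where uv: "e = {u, v}" using simple_edgeD(2)[OF sG e] by (auto simp: card_2_iff)
    then have V: "u \<in> verts G" "v \<in> verts G" using simple_edgeD(1)[OF sG e] by auto
    then have "{f u, f v} \<in> edges P" using f e uv by simp
    moreover have "e = h ` {f u, f v}" using uv V hf by simp
    ultimately show "e \<in> image h ` edges P" by blast
  next
    fix e assume "e \<in> image h ` edges P"
    then obtain d where d: "d \<in> edges P" "e = h ` d" by blast
    then obtain a b where ab: "d = {a, b}" using simple_edgeD(2)[OF sP d(1)] by (auto simp: card_2_iff)
    then have V: "a \<in> verts P" "b \<in> verts P" using simple_edgeD(1)[OF sP d(1)] by auto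
    then show "e \<in> edges G" using f[of "h a" "h b"] fh d ab by simp
  qed
  then show "\<exists>h. inj_on h (verts P) \<and> G = image_graph h P"
    using bh by (intro exI[of _ h]) (auto simp: image_graph_def bij_betw_def prod_eq_iff)
next
  assume "\<exists>h. inj_on h (verts P) \<and> G = image_graph h P"
  then obtain h where inj: "inj_on h (verts P)" and G: "G = image_graph h P" by blast
  define f where "f = inv_into (verts P) h"
  have bh: "bij_betw h (verts P) (verts G)" using inj G by (simp add: image_graph_def bij_betw_def)
  have hf: "h (f x) = x" if "x \<in> verts G" for x
    using bh that by (simp add: f_def bij_betw_inv_into_right)
  have fV: "f x \<in> verts P" if "x \<in> verts G" for x
    using bij_betwE[OF bij_betw_inv_into[OF bh]] that by (simp add: f_def)
  have "{u, v} \<in> edges G \<longleftrightarrow> {f u, f v} \<in> edges P" if V: "u \<in> verts G" "v \<in> verts G" for u v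
  proof -
    have "{u, v} \<in> edges G \<longleftrightarrow> h ` {f u, f v} \<in> image h ` edges P"
      using G V hf by (simp add: image_graph_def)
    also have "\<dots> \<longleftrightarrow> {f u, f v} \<in> edges P"
    proof (rule inj_on_image_mem_iff)
      show "inj_on (image h) (Pow (verts P))" using inj by (rule inj_on_image_Pow)
    qed (use V fV simple_edgeD(1)[OF sP] in auto)
    finally show ?thesis .
  qed
  moreover have "bij_betw f (verts G) (verts P)"
    unfolding f_def by (rule bij_betw_inv_into[OF bh])
  ultimately show "graph_iso G P" unfolding graph_iso_def by blast
qed

lemma image_graph_cong:
  assumes "\<And>x. x \<in> verts P \<Longrightarrow> h x = h' x" "\<And>e. e \<in> edges P \<Longrightarrow> e \<subseteq> verts P"
  shows "image_graph h P = image_graph h' P"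
proof -
  have "h ` e = h' ` e" if "e \<in> edges P" for e
    using assms that by (intro image_cong) auto
  then show ?thesis using assms(1) by (simp add: image_graph_def)
qed

lemma image_graph_id: "image_graph (\<lambda>x. x) P = P"
  by (simp add: image_graph_def)

text \<open>The free origin \<open>u\<close> is what later allows any vertex of the cycle to play
  the role of the centre \<open>0\<close>.\<close>

lemma (in cyclic_labelling) cyc_eq_image_graph:
  "cyc = image_graph (\<lambda>j. c (u + int j)) (cycle_graph g)"
proof -
  have "c (u + int (Suc j mod g)) = c (u + int j + 1)" for j
  proof -
    have "int g dvd int (Suc j mod g) - (int j + 1)"
      by (simp add: zmod_int mod_eq_dvd_iff[symmetric] add.commute)
    then show ?thesis by (simp add: c_eq_iff algebra_simps)
  qed
  then have "(\<lambda>j. c (u + int j)) ` {j, Suc j mod g} = cedge (u + int j)" for j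
    by (simp add: cedge_def)
  then have "image (image (\<lambda>j. c (u + int j))) ((\<lambda>j. {j, Suc j mod g}) ` {..<g})
      = (\<lambda>j. cedge (u + int j)) ` {..<g}"
    unfolding image_image by simp
  moreover have "{{j, Suc j mod g} | j. j < g} = (\<lambda>j. {j, Suc j mod g}) ` {..<g}" by auto
  ultimately have "image (image (\<lambda>j. c (u + int j))) {{j, Suc j mod g} | j. j < g}
      = (\<lambda>j. cedge (u + int j)) ` {..<g}" by (simp only:)
  then show ?thesis
    using range_c[of u] range_cedge[of u]
    by (simp add: image_graph_def cycle_graph_def cyc_def lessThan_atLeast0)
qed

lemma cycle_graph_edges_sub: "e \<in> edges (cycle_graph g) \<Longrightarrow> e \<subseteq> {0..<g}"
  by (auto simp: cycle_graph_def)

text \<open>A labelling of \<open>0, ..., g - 1\<close> extends periodically to the integers by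
  taking residues.\<close>

lemma cyclic_labelling_of_inj:
  assumes g: "3 \<le> g" and inj: "inj_on h {0..<g}"
  defines "c \<equiv> (\<lambda>i. h (nat (i mod int g)))"
  shows "cyclic_labelling c g" "image_graph h (cycle_graph g) = cyclic_labelling.cyc c"
proof -
  have lt: "nat (i mod int g) \<in> {0..<g}" for i using g by (auto simp: nat_less_iff)
  show cl: "cyclic_labelling c g"
  proof
    fix i j
    have "c i = c j \<longleftrightarrow> nat (i mod int g) = nat (j mod int g)"
      unfolding c_def using inj_on_eq_iff[OF inj lt lt] .
    also have "\<dots> \<longleftrightarrow> i mod int g = j mod int g"
      using g by (subst eq_nat_nat_iff) auto
    also have "\<dots> \<longleftrightarrow> int g dvd i - j" by (rule mod_eq_dvd_iff)
    finally show "c i = c j \<longleftrightarrow> int g dvd i - j" .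
  qed (rule g)
  show "image_graph h (cycle_graph g) = cyclic_labelling.cyc c"
    unfolding cyclic_labelling.cyc_eq_image_graph[OF cl, of 0]
    by (rule image_graph_cong) (auto simp: cycle_graph_def c_def)
qed

lemma simple_cycle_graph: "3 \<le> k \<Longrightarrow> simple_graph (cycle_graph k)"
  using cyclic_labelling_of_inj[of k "\<lambda>x. x"] cyclic_labelling.simple_cyc
  by (metis image_graph_id inj_on_id2)

lemma is_cycle_iff: "is_cycle D \<longleftrightarrow> (\<exists>c g. cyclic_labelling c g \<and> D = cyclic_labelling.cyc c)"
proof
  assume "is_cycle D"
  then obtain k where k: "3 \<le> k" "graph_iso D (cycle_graph k)" and sD: "simple_graph D"
    by (auto simp: is_cycle_def)
  then obtain h where h: "inj_on h (verts (cycle_graph k))" "D = image_graph h (cycle_graph k)"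
    using graph_iso_iff_image_graph[OF sD simple_cycle_graph] by blast
  from h(1) have "inj_on h {0..<k}" by (simp add: cycle_graph_def)
  with cyclic_labelling_of_inj[OF k(1)] h(2)
  show "\<exists>c g. cyclic_labelling c g \<and> D = cyclic_labelling.cyc c" by metis
next
  assume "\<exists>c g. cyclic_labelling c g \<and> D = cyclic_labelling.cyc c"
  then obtain c g where cl: "cyclic_labelling c g" and D: "D = cyclic_labelling.cyc c" by blast
  have sD: "simple_graph D" using cl D by (simp add: cyclic_labelling.simple_cyc)
  have g: "3 \<le> g" using cl by (rule cyclic_labelling.g3)
  have "inj_on (\<lambda>j. c (0 + int j)) (verts (cycle_graph g))"
    by (rule cyclic_labelling.inj_on_shift(1)[OF cl]) (auto simp: cycle_graph_def)
  then have "graph_iso D (cycle_graph g)"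
    unfolding graph_iso_iff_image_graph[OF sD simple_cycle_graph[OF g]]
    using D cyclic_labelling.cyc_eq_image_graph[OF cl, of 0] by blast
  with sD g show "is_cycle D" by (auto simp: is_cycle_def)
qed

text \<open>This provides the base n = g for the inductions on the number of pendant
  vertices.\<close>

lemma pineapple_self: "pineapple g g = cycle_graph g"
  by (auto simp: pineapple_def cycle_graph_def)

lemma verts_pineapple: "verts (pineapple n g) = {0..<n}"
  by (simp add: pineapple_def)

lemma image_graph_pineapple_Suc:
  assumes "g \<le> n"
  shows "image_graph h (pineapple (Suc n) g) = add_leaf (h 0) (h n) (image_graph h (pineapple n g))"
proof -
  have "{{0, i} | i. g \<le> i \<and> i < Suc n} = insert {0, n} {{0, i} | i. g \<le> i \<and> i < n}"
    using assms by (auto simp: less_Suc_eq)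
  then show ?thesis
    by (simp add: image_graph_def pineapple_def add_leaf_def atLeastLessThanSuc)
qed

lemma pineapple_edges_sub: "0 < n \<Longrightarrow> g \<le> n \<Longrightarrow> e \<in> edges (pineapple n g) \<Longrightarrow> e \<subseteq> verts (pineapple n g)"
  using cycle_graph_edges_sub[of e g] by (fastforce simp: pineapple_def)

section \<open>Unicyclic graphs grown from a cycle\<close>

text \<open>Both index bounds and the uniqueness of the cycle are proved along this construction;
  the fixed parameter \<open>g\<close> is the length of the initial cycle and turns out to be the
  girth.\<close>

inductive grown :: "nat \<Rightarrow> 'a graph \<Rightarrow> bool" for g where
  cyc: "cyclic_labelling c g \<Longrightarrow> grown g (cyclic_labelling.cyc c)"
| leaf: "grown g G \<Longrightarrow> u \<in> verts G \<Longrightarrow> v \<notin> verts G \<Longrightarrow> grown g (add_leaf u v G)"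

lemma grown_connected: "grown g G \<Longrightarrow> connected_graph G"
  by (induction rule: grown.induct) (auto intro: cyclic_labelling.connected_cyc connected_add_leaf)

lemmas grown_simple = connected_imp_simple[OF grown_connected]

lemma grown_girth_ge3: "grown g G \<Longrightarrow> 3 \<le> g"
  by (induction rule: grown.induct) (auto intro: cyclic_labelling.g3)

lemma grown_card_ge: "grown g G \<Longrightarrow> g \<le> card (verts G)"
proof (induction rule: grown.induct)
  case (leaf G u v)
  then show ?case using simple_finite(1)[OF grown_simple[OF leaf.hyps(1)]] by simp
qed (simp add: cyclic_labelling.card_cyc)

lemma card_add_leaf: "simple_graph G \<Longrightarrow> v \<notin> verts G \<Longrightarrow> card (verts (add_leaf u v G)) = Suc (card (verts G))"
  by (simp add: simple_finite(1))

lemma grown_pineapple: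
  assumes "3 \<le> g" "g \<le> n" "inj_on h {0..<n}"
  shows "grown g (image_graph h (pineapple n g))"
  using assms(2,3)
proof (induction n rule: dec_induct)
  case base
  then show ?case
    using cyclic_labelling_of_inj[OF assms(1)] grown.cyc by (metis pineapple_self)
next
  case (step n)
  have "inj_on h {0..<n}" using step.prems by (rule inj_on_subset) auto
  moreover have "h n \<notin> h ` {0..<n}"
    using step.prems inj_on_image_mem_iff[of h "{0..<Suc n}" n "{0..<n}"] by auto
  moreover have "h 0 \<in> h ` {0..<n}" using step.hyps assms(1) by auto
  ultimately show ?case
    unfolding image_graph_pineapple_Suc[OF step.hyps(1)] using step.IH
    by (auto intro!: grown.leaf simp: image_graph_def verts_pineapple)
qed

section \<open>Extremal values and the inductive bounds\<close>

definition rooted_max :: "nat \<Rightarrow> nat \<Rightarrow> nat" where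
  "rooted_max n g = 2 ^ (n - g) * ((\<Sum>l<g. Suc l) + 1)"

text \<open>Starting from F(C_g) = g^2 + 1, each passage from m to m + 1 vertices adds 1 +
  \<open>rooted_max m g\<close>. Summing over g <= m < n gives n - g and a geometric series with
  total factor 2^(n-g) - 1.\<close>

definition core_max :: "nat \<Rightarrow> nat \<Rightarrow> nat" where
  "core_max n g = (n - g) + (g\<^sup>2 + 1) + (2 ^ (n - g) - 1) * ((\<Sum>l<g. Suc l) + 1)"

lemma rooted_max_Suc: "g \<le> n \<Longrightarrow> rooted_max (Suc n) g = 2 * rooted_max n g"
  by (simp add: rooted_max_def Suc_diff_le)

lemma core_max_Suc:
  assumes "g \<le> n"
  shows "core_max (Suc n) g = core_max n g + 1 + rooted_max n g"
proof -
  define A where "A = (\<Sum>l<g. Suc l) + 1"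
  \<comment> \<open>Writing the power as a successor makes the truncated subtraction of 1
    exact.\<close>
  obtain p where p: "(2::nat) ^ (n - g) = Suc p" by (metis not0_implies_Suc power_not_zero zero_neq_numeral)
  show ?thesis unfolding core_max_def rooted_max_def A_def[symmetric] Suc_diff_le[OF assms]
    by (simp add: p algebra_simps)
qed

text \<open>Each new leaf hangs at the centre \<open>h 0\<close>, so the rooted index there exactly
  doubles. Stating this for every injective \<open>h\<close> evaluates the model and all its copies
  together.\<close>

lemma pineapple_indices:
  assumes "3 \<le> g" "g \<le> n" "inj_on h {0..<n}"
  shows "core_index (image_graph h (pineapple n g)) = core_max n g \<and>
    rooted_index (h 0) (image_graph h (pineapple n g)) = rooted_max n g"
  using assms(2,3)
proof (induction n rule: dec_induct)
  case base
  let ?c = "\<lambda>i. h (nat (i mod int g))"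
  have cl: "cyclic_labelling ?c g" and eq: "image_graph h (pineapple g g) = cyclic_labelling.cyc ?c"
    using cyclic_labelling_of_inj[OF assms(1) base] by (simp_all add: pineapple_self)
  show ?case
    using cyclic_labelling.core_index_cyc[OF cl] cyclic_labelling.rooted_index_cyc[OF cl, of 0]
    by (simp add: eq core_max_def rooted_max_def)
next
  case (step n)
  let ?G = "image_graph h (pineapple n g)"
  have inj: "inj_on h {0..<n}" using step.prems by (rule inj_on_subset) auto
  have n: "h n \<notin> verts ?G"
    using step.prems inj_on_image_mem_iff[of h "{0..<Suc n}" n "{0..<n}"]
    by (auto simp: image_graph_def verts_pineapple)
  have z: "h 0 \<in> verts ?G" using step.hyps assms(1) by (auto simp: image_graph_def verts_pineapple)
  have sG: "simple_graph ?G" by (rule grown_simple[OF grown_pineapple[OF assms(1) step.hyps(1) inj]])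
  show ?case
    unfolding image_graph_pineapple_Suc[OF step.hyps(1)]
    using step.IH[OF inj] core_index_add_leaf[OF sG z n] rooted_index_add_leaf_le(2)[OF sG z n z]
    by (simp add: core_max_Suc[OF step.hyps(1)] rooted_max_Suc[OF step.hyps(1)])
qed

lemma pineapple_add_leaf:
  assumes G: "G = image_graph h (pineapple n g)" and inj: "inj_on h {0..<n}" and g: "0 < g" "g \<le> n"
    and v: "v \<notin> verts G"
  shows "\<exists>h'. inj_on h' {0..<Suc n} \<and> add_leaf (h 0) v G = image_graph h' (pineapple (Suc n) g) \<and> h' 0 = h 0"
proof (intro exI conjI)
  \<comment> \<open>The new model vertex \<open>n\<close> is sent to \<open>v\<close>. Since
    \<open>0 < n\<close>, the centre is not moved.\<close>
  let ?h = "h(n := v)"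
  have vn: "v \<notin> h ` {0..<n}" using v G by (simp add: image_graph_def verts_pineapple)
  then show "inj_on ?h {0..<Suc n}"
    using inj by (auto simp: inj_on_def atLeastLessThanSuc)
  show "?h 0 = h 0" using g by simp
  have "image_graph ?h (pineapple n g) = G"
    unfolding G using g pineapple_edges_sub[of n g]
    by (intro image_graph_cong) (auto simp: verts_pineapple)
  then show "add_leaf (h 0) v G = image_graph ?h (pineapple (Suc n) g)"
    unfolding image_graph_pineapple_Suc[OF g(2)] using g by simp
qed

text \<open>The vertex \<open>u\<close> varies in the induction because the index of a new leaf
  depends on that of its neighbour. The clause \<open>h 0 = u\<close> locates the centre; without
  it, a leaf attached at \<open>u\<close> could not be recognised as extending the
  pineapple.\<close>

lemma rooted_index_le:
  assumes "grown g G" "u \<in> verts G"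
  shows "rooted_index u G \<le> rooted_max (card (verts G)) g \<and>
    (rooted_index u G = rooted_max (card (verts G)) g \<longrightarrow>
      (\<exists>h. inj_on h {0..<card (verts G)} \<and> G = image_graph h (pineapple (card (verts G)) g) \<and> h 0 = u))"
  using assms
proof (induction arbitrary: u rule: grown.induct)
  case (cyc c)
  then interpret cyclic_labelling c g by simp
  obtain k where k: "u = c k" using cyc.prems by (auto simp: cyc_def)
  \<comment> \<open>On the bare cycle the bound is attained at every vertex, so the copy is rotated
    to put \<open>u\<close> at the origin.\<close>
  have "inj_on (\<lambda>j. c (k + int j)) {0..<g}" by (rule inj_on_shift(1)) auto
  then have "\<exists>h. inj_on h {0..<g} \<and> local.cyc = image_graph h (pineapple g g) \<and> h 0 = u"
    using cyc_eq_image_graph[of k] k by (intro exI[of _ "\<lambda>j. c (k + int j)"]) (simp add: pineapple_self)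
  then show ?case
    using rooted_index_cyc[of k] k by (simp add: card_cyc rooted_max_def)
next
  case (leaf G x v)
  have sG: "simple_graph G" by (rule grown_simple[OF leaf.hyps(1)])
  define n where "n = card (verts G)"
  have card: "card (verts (add_leaf x v G)) = Suc n" using card_add_leaf[OF sG leaf.hyps(3)] n_def by simp
  have gn: "g \<le> n" "3 \<le> g" using grown_card_ge[OF leaf.hyps(1)] grown_girth_ge3[OF leaf.hyps(1)] n_def by auto
  show ?case unfolding card rooted_max_Suc[OF gn(1)]
  proof (cases "u = v")
    case True
    have "rooted_index u (add_leaf x v G) = 1 + rooted_index x G"
      using rooted_index_leaf[OF sG leaf.hyps(2,3)] True by simp
    also have "\<dots> \<le> 1 + rooted_max n g" using leaf.IH[OF leaf.hyps(2)] n_def by simp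
    \<comment> \<open>A new leaf is never extremal: 1 + M < 2M as soon as M >= 2.\<close>
    also have "\<dots> < 2 * rooted_max n g"
    proof -
      have "1 * 2 \<le> rooted_max n g" unfolding rooted_max_def
      proof (rule mult_le_mono)
        have "0 < (\<Sum>l<g. Suc l)" using gn(2) by (intro sum_pos) (auto simp: lessThan_empty_iff)
        then show "2 \<le> (\<Sum>l<g. Suc l) + 1" by linarith
      qed simp
      then show ?thesis by simp
    qed
    finally show "rooted_index u (add_leaf x v G) \<le> 2 * rooted_max n g \<and>
      (rooted_index u (add_leaf x v G) = 2 * rooted_max n g \<longrightarrow>
      (\<exists>h. inj_on h {0..<Suc n} \<and> add_leaf x v G = image_graph h (pineapple (Suc n) g) \<and> h 0 = u))"
      by simp
  next
    case False
    then have u: "u \<in> verts G" using leaf.prems by simp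
    note le = rooted_index_add_leaf_le[OF sG leaf.hyps(2,3) u]
    note IH = leaf.IH[OF u, folded n_def]
    have "\<exists>h. inj_on h {0..<Suc n} \<and> add_leaf x v G = image_graph h (pineapple (Suc n) g) \<and> h 0 = u"
      if eq: "rooted_index u (add_leaf x v G) = 2 * rooted_max n g"
    proof -
      \<comment> \<open>The index is at most twice its old value, itself at most the old maximum.
        Equality of the outer terms makes the old value maximal and the doubling exact, so the leaf
        hangs at \<open>u\<close>.\<close>
      have r: "rooted_index u G = rooted_max n g" using eq le(1) IH by linarith
      then have "x = u" using eq le(2) by simp
      then obtain h where h: "inj_on h {0..<n}" "G = image_graph h (pineapple n g)" "h 0 = u"
        using IH r by blast
      show ?thesis
        using pineapple_add_leaf[OF h(2,1) _ gn(1) leaf.hyps(3)] gn(2) h(3) \<open>x = u\<close> by auto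
    qed
    moreover have "rooted_index u (add_leaf x v G) \<le> 2 * rooted_max n g" using le(1) IH by linarith
    ultimately show "rooted_index u (add_leaf x v G) \<le> 2 * rooted_max n g \<and>
      (rooted_index u (add_leaf x v G) = 2 * rooted_max n g \<longrightarrow>
      (\<exists>h. inj_on h {0..<Suc n} \<and> add_leaf x v G = image_graph h (pineapple (Suc n) g) \<and> h 0 = u))"
      by blast
  qed
qed

lemma core_index_le:
  assumes "grown g G"
  shows "core_index G \<le> core_max (card (verts G)) g \<and>
    (core_index G = core_max (card (verts G)) g \<longrightarrow>
      (\<exists>h. inj_on h {0..<card (verts G)} \<and> G = image_graph h (pineapple (card (verts G)) g)))"
  using assms
proof (induction rule: grown.induct)
  case (cyc c)
  then interpret cyclic_labelling c g by simp
  have "inj_on (\<lambda>j. c (0 + int j)) {0..<g}" by (rule inj_on_shift(1)) auto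
  then have "\<exists>h. inj_on h {0..<g} \<and> local.cyc = image_graph h (pineapple g g)"
    using cyc_eq_image_graph[of 0] unfolding pineapple_self by blast
  then show ?case
    using core_index_cyc by (simp add: card_cyc core_max_def)
next
  case (leaf G x v)
  have sG: "simple_graph G" by (rule grown_simple[OF leaf.hyps(1)])
  define n where "n = card (verts G)"
  have card: "card (verts (add_leaf x v G)) = Suc n" using card_add_leaf[OF sG leaf.hyps(3)] n_def by simp
  have gn: "g \<le> n" "3 \<le> g" using grown_card_ge[OF leaf.hyps(1)] grown_girth_ge3[OF leaf.hyps(1)] n_def by auto
  note IH = leaf.IH[folded n_def]
  note rooted = rooted_index_le[OF leaf.hyps(1,2), folded n_def]
  note core = core_index_add_leaf[OF sG leaf.hyps(2,3)]
  have "\<exists>h. inj_on h {0..<Suc n} \<and> add_leaf x v G = image_graph h (pineapple (Suc n) g)"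
    if eq: "core_index (add_leaf x v G) = core_max (Suc n) g"
  proof -
    \<comment> \<open>Both summands of the recursion are bounded by those of
      \<open>core_max\<close>, so equality of the sums gives equality for the rooted index at
      \<open>x\<close>. This already determines \<open>G\<close> and makes \<open>x\<close> its
      centre.\<close>
    have "rooted_index x G = rooted_max n g"
      using eq IH rooted core core_max_Suc[OF gn(1)] by linarith
    then obtain h where h: "inj_on h {0..<n}" "G = image_graph h (pineapple n g)" "h 0 = x"
      using rooted by blast
    then show ?thesis
      using pineapple_add_leaf[OF h(2,1) _ gn(1) leaf.hyps(3)] gn(2) by auto
  qed
  moreover have "core_index (add_leaf x v G) \<le> core_max (Suc n) g"
    using IH rooted core core_max_Suc[OF gn(1)] by linarith
  ultimately show ?case unfolding card by blast
qed

section \<open>The cycle of a unicyclic graph\<close>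

text \<open>The degree bound puts every edge of \<open>G\<close> at a vertex of \<open>D\<close>
  into \<open>D\<close>, so \<open>verts D\<close> is closed in \<open>G\<close>. This excludes
  proper subcycles of a cycle and also shows that a cycle found in a 2-regular connected graph is
  the whole graph.\<close>

lemma subgraph_eq_of_degree_ge:
  assumes con: "connected_graph G" and sub: "subgraph D G" and ne: "verts D \<noteq> {}"
    and deg: "\<And>x. x \<in> verts D \<Longrightarrow> card {e \<in> edges G. x \<in> e} \<le> card {e \<in> edges D. x \<in> e}"
  shows "D = G"
proof -
  have sD: "simple_graph D" and sG: "simple_graph G" and V: "verts D \<subseteq> verts G"
    and E: "edges D \<subseteq> edges G"
    using sub con by (auto simp: subgraph_def connected_imp_simple)
  have eD: "e \<in> edges D" if e: "e \<in> edges G" and x: "x \<in> e" "x \<in> verts D" for e x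
  proof -
    have "{e \<in> edges D. x \<in> e} = {e \<in> edges G. x \<in> e}"
      using deg[OF x(2)] E simple_finite(2)[OF sG] by (intro card_seteq) auto
    with e x show ?thesis by blast
  qed
  have VV: "verts D = verts G"
  proof (rule connected_closed_eq[OF con V ne])
    fix e assume e: "e \<in> edges G" "e \<inter> verts D \<noteq> {}"
    then have "e \<in> edges D" using eD by blast
    then show "e \<subseteq> verts D" by (rule simple_edgeD(1)[OF sD])
  qed
  moreover have "edges G \<subseteq> edges D"
  proof
    fix e assume e: "e \<in> edges G"
    then obtain x where "x \<in> e" using simple_edgeD(2)[OF sG e] by fastforce
    then show "e \<in> edges D" using eD[OF e] simple_edgeD(1)[OF sG e] VV by blast
  qed
  ultimately show ?thesis using E by (auto simp: prod_eq_iff)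
qed

lemma is_cycle_degree:
  assumes "is_cycle D" "x \<in> verts D"
  shows "card {e \<in> edges D. x \<in> e} = 2"
proof -
  obtain c g where cl: "cyclic_labelling c g" and D: "D = cyclic_labelling.cyc c"
    using assms(1) by (auto simp: is_cycle_iff)
  interpret cyclic_labelling c g by (rule cl)
  obtain i where "x = c i" using assms(2) D by (auto simp: cyc_def)
  then show ?thesis using card_cedges_at[of i] D by (simp add: cyc_def)
qed

lemma is_cycle_connected: "is_cycle D \<Longrightarrow> connected_graph D"
  using cyclic_labelling.connected_cyc by (auto simp: is_cycle_iff)

lemma subcycle_eq:
  assumes "is_cycle C" "is_cycle D" "subgraph D C"
  shows "D = C"
proof (rule subgraph_eq_of_degree_ge)
  show "connected_graph C" by (rule is_cycle_connected[OF assms(1)])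
  show "subgraph D C" by (rule assms(3))
  show "verts D \<noteq> {}" using is_cycle_connected[OF assms(2)] by (simp add: connected_graph_def)
  fix x assume x: "x \<in> verts D"
  then have "x \<in> verts C" using assms(3) by (auto simp: subgraph_def)
  with x show "card {e \<in> edges C. x \<in> e} \<le> card {e \<in> edges D. x \<in> e}"
    using is_cycle_degree[OF assms(1)] is_cycle_degree[OF assms(2)] by simp
qed

text \<open>A new leaf lies on at most one edge while cycle vertices lie on two, so attaching it
  creates no cycle.\<close>

lemma grown_unique_cycle:
  assumes "grown g G"
  shows "\<exists>C. is_cycle C \<and> subgraph C G \<and> card (edges C) = g \<and> (\<forall>D. subgraph D G \<longrightarrow> is_cycle D \<longrightarrow> D = C)"
  using assms
proof (induction rule: grown.induct)
  case (cyc c)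
  then interpret cyclic_labelling c g by simp
  have "is_cycle local.cyc" using cyclic_labelling_axioms by (auto simp: is_cycle_iff)
  moreover have "subgraph local.cyc local.cyc" using simple_cyc by (simp add: subgraph_def)
  ultimately show ?case using card_cyc subcycle_eq by blast
next
  case (leaf G u v)
  then obtain C where C: "is_cycle C" "subgraph C G" "card (edges C) = g"
    and uni: "\<And>D. subgraph D G \<Longrightarrow> is_cycle D \<Longrightarrow> D = C" by blast
  have sG: "simple_graph G" by (rule grown_simple[OF leaf.hyps(1)])
  have "D = C" if D: "subgraph D (add_leaf u v G)" "is_cycle D" for D
  proof (rule uni[OF _ D(2)])
    have "v \<notin> verts D"
    proof
      assume "v \<in> verts D"
      then have "card {e \<in> edges D. v \<in> e} = 2" by (rule is_cycle_degree[OF D(2)])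
      moreover have "{e \<in> edges D. v \<in> e} \<subseteq> {{u, v}}"
        using D(1) leaf.hyps(3) simple_edgeD(1)[OF sG] by (auto simp: subgraph_def)
      then have "card {e \<in> edges D. v \<in> e} \<le> card {{u, v}}" by (intro card_mono) auto
      ultimately show False by simp
    qed
    moreover have "{u, v} \<notin> edges D"
      using D(1) calculation simple_edgeD(1)[of D "{u, v}"] by (auto simp: subgraph_def)
    ultimately show "subgraph D G" using D(1) by (auto simp: subgraph_def)
  qed
  moreover have "subgraph C (add_leaf u v G)" using C(2) by (auto simp: subgraph_def)
  ultimately show ?case using C by (intro exI[of _ C] conjI allI impI)
qed

lemma grown_girth:
  assumes "grown g G"
  shows "girth G = g"
proof -
  obtain C where C: "is_cycle C" "subgraph C G" "card (edges C) = g"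
    and uni: "\<And>D. subgraph D G \<Longrightarrow> is_cycle D \<Longrightarrow> D = C"
    using grown_unique_cycle[OF assms] by blast
  have "(THE C. subgraph C G \<and> is_cycle C) = C" 
  proof (rule the_equality)
    show "subgraph C G \<and> is_cycle C" using C by blast
    show "D = C" if "subgraph D G \<and> is_cycle D" for D using uni[of D] that by blast
  qed

  with C show ?thesis by (simp add: girth_def)
qed

section \<open>Every unicyclic graph grows from a cycle\<close>

lemma cyclic_labelling_of_list:
  assumes "distinct xs" "3 \<le> length xs"
  shows "cyclic_labelling (\<lambda>i. xs ! nat (i mod int (length xs))) (length xs)"
  using assms by (intro cyclic_labelling_of_inj(1)) (auto simp: inj_on_def nth_eq_iff_index_eq)

text \<open>A longest path in a 2-regular graph closes up to a cycle: every neighbour of its end lies on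
  the path, and the interior vertices have no edges left.\<close>

lemma two_regular_is_cycle:
  assumes con: "connected_graph G" and deg: "\<And>x. x \<in> verts G \<Longrightarrow> card {e \<in> edges G. x \<in> e} = 2"
  shows "is_cycle G"
proof -
  have sG: "simple_graph G" by (rule connected_imp_simple[OF con])
  define P where "P = {xs. xs \<noteq> [] \<and> distinct xs \<and> set xs \<subseteq> verts G \<and>
    (\<forall>i. Suc i < length xs \<longrightarrow> {xs ! i, xs ! Suc i} \<in> edges G)}"
  obtain x0 where x0: "x0 \<in> verts G" using con unfolding connected_graph_def by blast
  have x0P: "[x0] \<in> P" using x0 by (simp add: P_def)
  have bound: "length xs < Suc (card (verts G))" if "xs \<in> P" for xs
    using that card_mono[OF simple_finite(1)[OF sG], of "set xs"]
    by (simp add: P_def distinct_card)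
  obtain xs where xs: "xs \<in> P" and max: "\<And>ys. ys \<in> P \<Longrightarrow> length ys \<le> length xs"
    using ex_has_greatest_nat[of "\<lambda>xs. xs \<in> P" "[x0]" length "Suc (card (verts G))"] x0P bound by blast
  define k where "k = length xs"
  have ne: "xs \<noteq> []" and dist: "distinct xs" and V: "set xs \<subseteq> verts G"
    and path: "\<And>i. Suc i < k \<Longrightarrow> {xs ! i, xs ! Suc i} \<in> edges G"
    using xs by (auto simp: P_def k_def)
  have k0: "0 < k" using ne by (simp add: k_def)
  have nth_eq: "xs ! i = xs ! j \<longleftrightarrow> i = j" if "i < k" "j < k" for i j
    using dist that by (simp add: k_def nth_eq_iff_index_eq)
  have nth_V: "xs ! i \<in> verts G" if "i < k" for i using V that k_def by auto
  define z where "z = xs ! (k - 1)"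
  have zV: "z \<in> verts G" unfolding z_def using k0 by (intro nth_V) simp
  have nbr_z: "\<exists>j<k - 1. e = {z, xs ! j}" if e: "e \<in> edges G" "z \<in> e" for e
  proof -
    obtain y where y: "y \<noteq> z" "y \<in> verts G" "e = {z, y}" using simple_edge_at[OF sG e] .
    have "y \<in> set xs"
    proof (rule ccontr)
      assume ynew: "y \<notin> set xs"
      have "{(xs @ [y]) ! i, (xs @ [y]) ! Suc i} \<in> edges G" if "Suc i < length (xs @ [y])" for i
      proof (cases "Suc i < k")
        case True
        then show ?thesis using path[OF True] by (simp add: nth_append k_def)
      next
        case False
        then have "i = k - 1" "Suc i = k" using that k0 by (auto simp: k_def)
        then show ?thesis using e y k0 by (simp add: nth_append k_def z_def)
      qed
      then have "xs @ [y] \<in> P" using dist V ynew y by (simp add: P_def)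
      from max[OF this] show False by simp
    qed
    then obtain j where j: "j < k" "y = xs ! j" by (auto simp: in_set_conv_nth k_def)
    moreover have "j \<noteq> k - 1" using j y by (auto simp: z_def)
    ultimately show ?thesis using y by (intro exI[of _ j]) auto
  qed
  have k1: "1 < k"
  proof -
    have "{e \<in> edges G. z \<in> e} \<noteq> {}" using deg[OF zV] by fastforce
    with nbr_z show ?thesis by fastforce
  qed
  then have pre: "{xs ! (k - 2), z} \<in> edges G"
    using path[of "k - 2"] by (simp add: z_def Suc_diff_le numeral_2_eq_2 Suc_diff_Suc)
  have "\<exists>e. e \<in> edges G \<and> z \<in> e \<and> e \<noteq> {xs ! (k - 2), z}"
  proof (rule ccontr)
    assume "\<not> ?thesis"
    then have "{e \<in> edges G. z \<in> e} \<subseteq> {{xs ! (k - 2), z}}" by blast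
    then have "card {e \<in> edges G. z \<in> e} \<le> card {{xs ! (k - 2), z}}" by (intro card_mono) auto
    then show False using deg[OF zV] by simp
  qed
  then obtain e where e: "e \<in> edges G" "z \<in> e" "e \<noteq> {xs ! (k - 2), z}" by blast
  obtain j where j: "j < k - 1" "e = {z, xs ! j}" using nbr_z[OF e(1,2)] by blast
  have j2: "j \<noteq> k - 2" using e(3) j by (auto simp: insert_commute)
  have "j = 0"
  proof (rule ccontr)
    assume j0: "j \<noteq> 0"
    \<comment> \<open>If the second neighbour of \<open>z\<close> were interior, it would carry its
      two path edges and the edge to \<open>z\<close>, three in all. They are distinct because
      \<open>j\<close> is not the index \<open>k - 2\<close> of the path neighbour of
      \<open>z\<close>.\<close>
    define e1 e2 where "e1 = {xs ! (j - 1), xs ! j}" and "e2 = {xs ! j, xs ! Suc j}"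
    have E: "e1 \<in> edges G" "e2 \<in> edges G"
      using path[of "j - 1"] path[of j] j j0 by (auto simp: e1_def e2_def)
    have "e1 \<noteq> e2" "e1 \<noteq> e" "e2 \<noteq> e"
      using j j0 j2 k1 by (auto simp: e1_def e2_def z_def doubleton_eq_iff nth_eq)
    then have "card {e1, e2, e} = 3" by simp
    moreover have "card {e1, e2, e} \<le> card {e \<in> edges G. xs ! j \<in> e}"
      using E e(1) j simple_finite(2)[OF sG] by (intro card_mono) (auto simp: e1_def e2_def)
    ultimately show False using deg[OF nth_V[of j]] j by simp
  qed
  \<comment> \<open>As the second edge at \<open>z\<close> differs from its path edge,
    \<open>0\<close> is not \<open>k - 2\<close>, which together with \<open>1 < k\<close> gives
    \<open>3 \<le> k\<close>.\<close>
  then have close: "{z, xs ! 0} \<in> edges G" and k3: "3 \<le> k" using e(1) j j2 by auto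
  let ?c = "\<lambda>i. xs ! nat (i mod int k)"
  have cl: "cyclic_labelling ?c k"
    using cyclic_labelling_of_list[OF dist] k3 by (simp add: k_def)
  interpret cyclic_labelling ?c k by (rule cl)
  have cyc: "is_cycle cyc" using cl by (auto simp: is_cycle_iff)
  \<comment> \<open>The path and its closing edge form a cycle inside \<open>G\<close>; since both
    have degree 2 at its vertices, nothing of \<open>G\<close> is left outside.\<close>
  have "cyc = G"
  proof (rule subgraph_eq_of_degree_ge[OF con])
    have "range ?c \<subseteq> verts G" using nth_V k0 by (auto simp: nat_less_iff)
    moreover have "cedge (0 + int i) \<in> edges G" if i: "i < k" for i
    proof (cases "Suc i = k")
      case True
      then have "?c (int i + 1) = xs ! 0" by (metis mod_self nat_zero_as_int of_nat_Suc add.commute)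
      moreover have "?c (int i) = z" using True i by (auto simp: z_def)
      ultimately show ?thesis using close by (simp add: cedge_def)
    next
      case False
      then have "Suc i < k" using i by simp
      then have "?c (int i + 1) = xs ! Suc i" "?c (int i) = xs ! i"
        by (simp_all add: nat_add_distrib)
      then show ?thesis using path[OF \<open>Suc i < k\<close>] by (simp add: cedge_def)
    qed
    then have "range cedge \<subseteq> edges G" unfolding range_cedge[of 0] by blast
    ultimately show sub: "subgraph cyc G" using simple_cyc by (simp add: subgraph_def cyc_def)
    show "verts cyc \<noteq> {}" by (simp add: cyc_def)
    fix x assume x: "x \<in> verts cyc"
    then have "x \<in> verts G" using sub by (auto simp: subgraph_def)
    then show "card {e \<in> edges G. x \<in> e} \<le> card {e \<in> edges cyc. x \<in> e}"
      using deg is_cycle_degree[OF cyc x] by simp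
  qed
  with cyc show ?thesis by simp
qed

lemma degree_sum:
  assumes sG: "simple_graph G"
  shows "(\<Sum>x\<in>verts G. card {e \<in> edges G. x \<in> e}) = 2 * card (edges G)"
proof -
  have "(\<Sum>x\<in>verts G. card {e \<in> edges G. x \<in> e}) = (\<Sum>e\<in>edges G. 2)"
  proof (rule sum_multicount_gen)
    show "\<forall>e\<in>edges G. card {x \<in> verts G. x \<in> e} = 2"
    proof
      fix e assume e: "e \<in> edges G"
      then have "{x \<in> verts G. x \<in> e} = e" using simple_edgeD(1)[OF sG e] by blast
      then show "card {x \<in> verts G. x \<in> e} = 2" using simple_edgeD(2)[OF sG e] by simp
    qed
  qed (use simple_finite[OF sG] in auto)
  then show ?thesis by simp
qed

text \<open>Removing a leaf deletes one vertex and one edge, so induction applies. Without leaves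
  all degrees are at least 2 and average exactly 2, so the graph is 2-regular and hence a
  cycle.\<close>

lemma unicyclic_grown: "unicyclic G \<Longrightarrow> \<exists>g. grown g G"
proof (induction "card (verts G)" arbitrary: G rule: less_induct)
  case less
  then have con: "connected_graph G" and card: "card (verts G) = card (edges G)"
    by (auto simp: unicyclic_def)
  have sG: "simple_graph G" by (rule connected_imp_simple[OF con])
  note fin = simple_finite[OF sG]
  let ?d = "\<lambda>x. card {e \<in> edges G. x \<in> e}"
  \<comment> \<open>An isolated vertex would be the whole connected graph; equality of the counts
    would then supply an edge, which has no room.\<close>
  have pos: "?d x \<noteq> 0" if x: "x \<in> verts G" for x
  proof
    assume "?d x = 0"
    then have no: "{e \<in> edges G. x \<in> e} = {}" using fin by simp
    then have "{x} = verts G" using x by (intro connected_closed_eq[OF con]) auto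
    moreover from this have "card (edges G) = 1" using card by (metis card_1_singleton_iff One_nat_def)
    then obtain e where e: "e \<in> edges G" by (auto simp: card_1_singleton_iff)
    ultimately have "e \<subseteq> {x}" "x \<notin> e" using simple_edgeD(1)[OF sG e] no by auto
    then have "e = {}" by blast
    then show False using simple_edgeD(2)[OF sG e] by simp
  qed
  show ?case
  proof (cases "\<exists>v\<in>verts G. ?d v = 1")
    case True
    then obtain v e where v: "v \<in> verts G" and ve: "{e \<in> edges G. v \<in> e} = {e}"
      by (auto simp: card_1_singleton_iff)
    then have e: "e \<in> edges G" "v \<in> e" by auto
    obtain u where u: "u \<noteq> v" "e = {v, u}" using simple_edge_at[OF sG e] by blast
    have "{u, v} \<in> edges G" using e u by (simp add: insert_commute)
    moreover have "d = {u, v}" if "d \<in> edges G" "v \<in> d" for d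
      using ve that u by (auto simp: insert_commute)
    ultimately obtain K where K: "connected_graph K" "u \<in> verts K" "v \<notin> verts K" "G = add_leaf u v K"
      using connected_remove_leaf[OF con v u(1)] by blast
    have sK: "simple_graph K" by (rule connected_imp_simple[OF K(1)])
    have "{u, v} \<notin> edges K" using K(3) simple_edgeD(1)[OF sK] by blast
    then have "unicyclic K" "card (verts K) < card (verts G)"
      using card K simple_finite[OF sK] by (auto simp: unicyclic_def)
    then obtain g where "grown g K" using less.hyps by blast
    then show ?thesis using grown.leaf[OF _ K(2,3)] K(4) by auto
  next
    case False
    then have ge: "2 \<le> ?d x" if "x \<in> verts G" for x using pos[OF that] that by fastforce
    have "?d x = 2" if x: "x \<in> verts G" for x
    proof (rule ccontr)
      assume "?d x \<noteq> 2"
      then have "2 < ?d x" using ge[OF x] by simp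
      then have "(\<Sum>x\<in>verts G. 2) < (\<Sum>x\<in>verts G. ?d x)"
        using x ge fin by (intro sum_strict_mono_ex1) auto
      then show False using degree_sum[OF sG] card by simp
    qed
    then have "is_cycle G" by (rule two_regular_is_cycle[OF con])
    then obtain c g where "cyclic_labelling c g" "G = cyclic_labelling.cyc c"
      unfolding is_cycle_iff by blast
    then show ?thesis using grown.cyc by (intro exI[of _ g]) simp
  qed
qed

text \<open>From \<open>m\<close> to \<open>Suc m\<close> both sides grow by m + 2: on the right, 2
  comes from the linear term and m from the binomial coefficient.\<close>

lemma sum_Suc_lessThan:
  assumes "1 \<le> g"
  shows "(\<Sum>l<g. Suc l) + 1 = 2 * g + ((g - 1) choose 2)"
proof -
  have "(\<Sum>l<Suc m. Suc l) + 1 = 2 * Suc m + (m choose 2)" for m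
    by (induction m) (auto simp: numeral_2_eq_2)
  from this[of "g - 1"] show ?thesis using assms by simp
qed

theorem theorem4p3:
  fixes n g :: nat
  assumes "3 \<le> g" and "g < n"
  shows "(\<forall>G :: 'a graph. unicyclic G \<and> card (verts G) = n \<and> girth G = g \<longrightarrow>
            core_index G \<le> core_index (pineapple n g) \<and>
            (core_index G = core_index (pineapple n g) \<longleftrightarrow> graph_iso G (pineapple n g)))
       \<and> core_index (pineapple n g) =
           n + g\<^sup>2 - g + 1 + (2 ^ (n - g) - 1) * (2 * g + ((g - 1) choose 2))"
proof (intro conjI allI impI)
  have gn: "g \<le> n" using assms(2) by simp
  have core: "core_index (pineapple n g) = core_max n g"
    using pineapple_indices[OF assms(1) gn, of "\<lambda>x. x"] by (simp add: image_graph_id)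
  have simple: "simple_graph (pineapple n g)"
    using grown_simple[OF grown_pineapple[OF assms(1) gn, of "\<lambda>x. x"]] by (simp add: image_graph_id)
  show "core_index (pineapple n g) =
      n + g\<^sup>2 - g + 1 + (2 ^ (n - g) - 1) * (2 * g + ((g - 1) choose 2))"
    \<comment> \<open>Because g <= n, the truncated (n - g) + g^2 agrees with n + g^2 - g.\<close>
    using gn assms(1) unfolding core core_max_def by (subst sum_Suc_lessThan) simp_all
  fix G :: "'a graph"
  assume G: "unicyclic G \<and> card (verts G) = n \<and> girth G = g"
  \<comment> \<open>The growth supplies some initial cycle length \<open>k\<close>; the girth
    identifies it with \<open>g\<close>.\<close>
  then obtain k where k: "grown k G" using unicyclic_grown by blast
  with G have grown: "grown g G" using grown_girth[OF k] by simp
  note bound = core_index_le[OF grown]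
  show "core_index G \<le> core_index (pineapple n g)" using bound G core by simp
  have "graph_iso G (pineapple n g) \<longleftrightarrow> (\<exists>h. inj_on h {0..<n} \<and> G = image_graph h (pineapple n g))"
    using graph_iso_iff_image_graph[OF grown_simple[OF grown] simple] by (simp add: verts_pineapple)
  also have "\<dots> \<longleftrightarrow> core_index G = core_max n g"
  proof
    assume "\<exists>h. inj_on h {0..<n} \<and> G = image_graph h (pineapple n g)"
    then show "core_index G = core_max n g" using pineapple_indices[OF assms(1) gn] by auto
  next
    assume "core_index G = core_max n g"
    then show "\<exists>h. inj_on h {0..<n} \<and> G = image_graph h (pineapple n g)" using bound G by simp
  qed
  finally show "core_index G = core_index (pineapple n g) \<longleftrightarrow> graph_iso G (pineapple n g)"
    using core by simp
qed

end
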